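(* Let $\alpha\in(0,2)$ with $\alpha\neq1$. Then for every integer $N\ge1$ there exists $m_*>0$ such that, for every $m\in(0,m_* )$, there exist $N$ periodic solutions, having period $2\pi$, of $$\ddot q=(1-m)\,\frac{m e^{it}-q}{|m e^{it}-q|^{\alpha+2}}-m\,\frac{(1-m)e^{it}+q}{|(1-m)e^{it}+q|^{\alpha+2}},\qquad q\in\mathbb{R}^2 .$$
   Context: Here $\mathbb{R}^2$ is identified with $\mathbb{C}$ and $m\in(0,1)$ is the normalized mass of one primary. The equation is the normalized restricted planar circular 3-body problem with a $-\alpha$-homogeneous interaction potential, with primaries of masses $1-m$ and $m$ at positions $\xi_M(t)=me^{it}$ and $\xi_m(t)=-(1-m)e^{it}$. Solutions are classical, i.e. $q(t)\neq\xi_M(t)$ and $q(t)\neq\xi_m(t)$ for all $t$. The $N$ solutions are pairwise distinct. *)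

theory Defs
  imports "HOL-Analysis.Analysis"
begin

text \<open>The plane is identified with the complex numbers, and \<^term>\<open>cis t\<close> is $e^{it}$.
  The heavy primary has mass \<open>1 - m\<close>, the light one has mass \<open>m\<close>; their centre of mass is \<open>0\<close>.\<close>

definition heavy_primary :: "real \<Rightarrow> real \<Rightarrow> complex" where
  "heavy_primary m t = m *\<^sub>R cis t"

definition light_primary :: "real \<Rightarrow> real \<Rightarrow> complex" where
  "light_primary m t = - ((1 - m) *\<^sub>R cis t)"

definition r3bp_force :: "real \<Rightarrow> real \<Rightarrow> real \<Rightarrow> complex \<Rightarrow> complex" where
  "r3bp_force \<alpha> m t z =
     (1 - m) *\<^sub>R ((m *\<^sub>R cis t - z) /\<^sub>R (norm (m *\<^sub>R cis t - z) powr (\<alpha> + 2)))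
     - m *\<^sub>R (((1 - m) *\<^sub>R cis t + z) /\<^sub>R (norm ((1 - m) *\<^sub>R cis t + z) powr (\<alpha> + 2)))"

text \<open>Classical solutions on the whole real line. Collisions are excluded explicitly: at a collision
  the corresponding summand of \<^const>\<open>r3bp_force\<close> would be \<open>0\<close> by the convention for division
  by zero. The velocity is \<open>v\<close>.\<close>

definition r3bp_solution :: "real \<Rightarrow> real \<Rightarrow> (real \<Rightarrow> complex) \<Rightarrow> bool" where
  "r3bp_solution \<alpha> m q \<longleftrightarrow>
     (\<forall>t. q t \<noteq> heavy_primary m t \<and> q t \<noteq> light_primary m t) \<and>
     (\<exists>v. \<forall>t. (q has_vector_derivative v t) (at t) \<and>
              (v has_vector_derivative r3bp_force \<alpha> m t (q t)) (at t))"

end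

theory Submission
  imports Defs
begin

text \<open>For \<open>m = 0\<close> the equation is the central force problem \<open>q'' = - q / |q|\<^sup>\<alpha>\<^sup>+\<^sup>2\<close>, whose circular
  orbits \<open>r e\<^sup>i\<^sup>k\<^sup>t\<close> with an integer \<open>k \<ge> 2\<close> and \<open>r = k powr (-2/(\<alpha>+2)) < 1\<close> are \<open>2\<pi>\<close>-periodic and stay
  away from the light primary. Writing \<open>q = r e\<^sup>i\<^sup>k\<^sup>t (1 + w)\<close>, the equation for \<open>m > 0\<close> becomes
  \<open>w'' + 2\<i>k w' - (\<alpha>+2) k\<^sup>2 Re w = G(t, w)\<close> with \<open>G\<close> small and with small Lipschitz constant near
  \<open>w = 0\<close>. The phase degeneracy of the linear part is removed by the reversibility of the problem:
  one works with \<open>2\<pi>\<close>-periodic \<open>w\<close> satisfying \<open>w(-t) = cnj (w(t))\<close>. On this space the linear part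
  is boundedly invertible unless its radial frequency \<open>\<omega> = k sqrt (2-\<alpha>)\<close> is an integer, so the
  contraction principle yields a solution. If \<open>\<omega>\<close> were an integer for both \<open>k\<close> and \<open>k + 1\<close>, then
  \<open>sqrt (2-\<alpha>)\<close> would be one, i.e. \<open>\<alpha> = 1\<close>; hence infinitely many \<open>k\<close> are admissible, and solutions
  for different \<open>k\<close> start near different radii.\<close>

subsection \<open>Antiderivatives of even, odd and periodic functions\<close>

text \<open>The interval integral is oriented, so for negative \<open>t\<close> this is still the
  antiderivative of \<open>f\<close> vanishing at \<open>0\<close>; the parity statements rely on
  it.\<close>

definition antideriv :: "(real \<Rightarrow> real) \<Rightarrow> real \<Rightarrow> real" where
  "antideriv f t = (LBINT s=ereal 0..ereal t. f s)"

lemma antideriv_0 [simp]: "antideriv f 0 = 0"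
  by (simp add: antideriv_def)

lemma DERIV_antideriv:
  assumes "continuous_on UNIV f"
  shows "(antideriv f has_real_derivative f t) (at t)"
proof -
  define R where "R = \<bar>t\<bar> + 1"
  have "((\<lambda>u. LBINT s=ereal 0..ereal u. f s) has_vector_derivative f t) (at t within {-R..R})"
    by (rule interval_integral_FTC2) (use assms in \<open>auto simp: R_def intro: continuous_on_subset\<close>)
  moreover have "at t within {-R..R} = at t"
    by (rule at_within_Icc_at) (auto simp: R_def)
  ultimately show ?thesis
    by (simp add: antideriv_def [abs_def] has_real_derivative_iff_has_vector_derivative)
qed

lemma DERIV_antideriv_chain [derivative_intros]:
  assumes "continuous_on UNIV f" "(h has_real_derivative d) (at t)" "f (h t) * d = D"
  shows "((\<lambda>t. antideriv f (h t)) has_real_derivative D) (at t)"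
  using DERIV_chain2 [OF DERIV_antideriv [OF assms(1)] assms(2)] assms(3) by simp

lemma continuous_on_antideriv [continuous_intros]:
  "continuous_on UNIV f \<Longrightarrow> continuous_on A (antideriv f)"
  by (meson DERIV_antideriv DERIV_isCont continuous_at_imp_continuous_on)

text \<open>The difference has zero derivative and vanishes at \<open>0\<close>. Identities between
  antiderivatives below are checked this way, by differentiating a candidate.\<close>

lemma antideriv_unique:
  assumes "\<And>t. (F has_real_derivative f t) (at t)" "F 0 = 0" "continuous_on UNIV f"
  shows "antideriv f t = F t"
proof -
  have "((\<lambda>t. antideriv f t - F t) has_real_derivative 0) (at t)" for t
    using assms by (auto intro!: derivative_eq_intros)
  then have "antideriv f t - F t = antideriv f 0 - F 0"
    by (intro DERIV_isconst_all) auto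
  then show ?thesis using assms by simp
qed

lemma antideriv_diff:
  assumes "continuous_on UNIV f" "continuous_on UNIV g"
  shows "antideriv (\<lambda>s. f s - g s) t = antideriv f t - antideriv g t"
  by (rule antideriv_unique) (use assms in \<open>auto intro!: derivative_eq_intros continuous_intros\<close>)

lemma antideriv_even:
  assumes "continuous_on UNIV f" "\<And>t. f (- t) = f t"
  shows "antideriv f (- t) = - antideriv f t"
proof -
  have "((\<lambda>t. - antideriv f (- t)) has_real_derivative f t) (at t)" for t
    using DERIV_minus [OF DERIV_antideriv_chain [OF assms(1) DERIV_minus [OF DERIV_ident] refl]] assms(2)
    by simp
  from antideriv_unique [OF this _ assms(1), of t] have "antideriv f t = - antideriv f (- t)"
    by simp
  then show ?thesis by linarith
qed

lemma antideriv_odd: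
  assumes "continuous_on UNIV f" "\<And>t. f (- t) = - f t"
  shows "antideriv f (- t) = antideriv f t"
proof -
  have "((\<lambda>t. antideriv f (- t)) has_real_derivative f t) (at t)" for t
    using DERIV_antideriv_chain [OF assms(1) DERIV_minus [OF DERIV_ident] refl] assms(2)
    by simp
  from antideriv_unique [OF this _ assms(1), of t] have "antideriv f t = antideriv f (- t)"
    by simp
  then show ?thesis by linarith
qed

text \<open>The increment over one period is constant, so it can be read off at \<open>- pi\<close>,
  where it vanishes by the third hypothesis: \<open>f\<close> has mean zero.\<close>

lemma antideriv_periodic:
  assumes "continuous_on UNIV f" "\<And>t. f (t + 2 * pi) = f t" "antideriv f (- pi) = antideriv f pi"
  shows "antideriv f (t + 2 * pi) = antideriv f t"
proof -
  have "((\<lambda>t. antideriv f (t + 2 * pi) - antideriv f (2 * pi)) has_real_derivative f t) (at t)" for t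
    by (rule DERIV_cong [OF DERIV_diff [OF DERIV_antideriv_chain
            [OF assms(1) DERIV_add [OF DERIV_ident DERIV_const] refl] DERIV_const]])
       (simp add: assms(2))
  from antideriv_unique [OF this _ assms(1)]
  have *: "antideriv f t = antideriv f (t + 2 * pi) - antideriv f (2 * pi)" for t
    by (metis add_0 diff_self)
  from *[of "- pi"] assms(3) have "antideriv f (2 * pi) = 0"
    by simp
  with *[of t] show ?thesis by simp
qed

lemma antideriv_bound:
  assumes "continuous_on UNIV f" "\<And>s. \<bar>f s\<bar> \<le> B"
  shows "\<bar>antideriv f t\<bar> \<le> B * \<bar>t\<bar>"
proof -
  have "norm (antideriv f t - antideriv f 0) \<le> B * norm (t - 0)"
    by (rule field_differentiable_bound [of UNIV _ f])
       (use assms in \<open>auto intro: DERIV_antideriv\<close>)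
  then show ?thesis by simp
qed

lemma periodic_reduce:
  assumes "\<And>t. f (t + 2 * pi) = f t"
  obtains s where "s \<in> {0..2 * pi}" "f t = f s"
proof -
  have n: "f (t + 2 * pi * real n) = f t" for n t
  proof (induction n)
    case (Suc n)
    then show ?case using assms[of "t + 2 * pi * real n"] by (simp add: algebra_simps)
  qed simp
  have i: "f (t + 2 * pi * of_int i) = f t" for i t
  proof (cases "i \<ge> 0")
    case True
    then show ?thesis using n[of t "nat i"] by simp
  next
    case False
    then show ?thesis using n[of "t + 2 * pi * of_int i" "nat (- i)"] by simp
  qed
  define k where "k = \<lfloor>t / (2 * pi)\<rfloor>"
  have "of_int k \<le> t / (2 * pi)" "t / (2 * pi) \<le> of_int k + 1"
    unfolding k_def by linarith+
  then have "2 * pi * of_int k \<le> t" "t \<le> 2 * pi * of_int k + 2 * pi"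
    by (simp_all add: field_simps)
  with i[of "t" "- k"] show ?thesis
    by (intro that [of "t - 2 * pi * of_int k"]) auto
qed

text \<open>Periodicity reduces to a single period, on which the linearly growing bound of
  \<open>antideriv_bound\<close> is at most \<open>2 * pi * B\<close>.\<close>

lemma antideriv_periodic_bound:
  assumes "continuous_on UNIV f" "\<And>t. f (t + 2 * pi) = f t" "antideriv f (- pi) = antideriv f pi"
    and "\<And>s. \<bar>f s\<bar> \<le> B"
  shows "\<bar>antideriv f t\<bar> \<le> 2 * pi * B"
proof -
  obtain s where s: "s \<in> {0..2 * pi}" "antideriv f t = antideriv f s"
    using periodic_reduce [of "antideriv f" t] antideriv_periodic [OF assms(1-3)] by blast
  have "0 \<le> B" using assms(4)[of 0] by linarith
  have "\<bar>antideriv f s\<bar> \<le> B * \<bar>s\<bar>"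
    by (rule antideriv_bound) (use assms in auto)
  also have "\<dots> \<le> B * (2 * pi)"
    using s \<open>0 \<le> B\<close> by (intro mult_left_mono) auto
  finally show ?thesis using s by (simp add: mult.commute)
qed

subsection \<open>Even periodic solutions of the forced oscillator\<close>

text \<open>The energy \<open>(d' t)\<^sup>2 + \<omega>\<^sup>2 * (d t)\<^sup>2\<close> is conserved
  and vanishes at \<open>s\<close>.\<close>

lemma harmonic_unique:
  fixes d d' :: "real \<Rightarrow> real"
  assumes "\<omega> \<noteq> 0" "\<And>t. (d has_real_derivative d' t) (at t)"
    "\<And>t. (d' has_real_derivative - \<omega>\<^sup>2 * d t) (at t)" "d s = 0" "d' s = 0"
  shows "d t = 0"
proof -
  have "((\<lambda>t. (d' t)\<^sup>2 + \<omega>\<^sup>2 * (d t)\<^sup>2) has_real_derivative 0) (at t)" for t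
    using assms(2,3) by (auto intro!: derivative_eq_intros)
  then have "(d' t)\<^sup>2 + \<omega>\<^sup>2 * (d t)\<^sup>2 = (d' s)\<^sup>2 + \<omega>\<^sup>2 * (d s)\<^sup>2"
    by (intro DERIV_isconst_all) auto
  with assms show ?thesis
    by (simp add: add_nonneg_eq_0_iff)
qed

text \<open>The cosine coefficient is chosen so that the derivative vanishes at \<open>pi\<close>.\<close>

definition osc_coeff :: "real \<Rightarrow> (real \<Rightarrow> real) \<Rightarrow> real" where
  "osc_coeff \<omega> f = (cos (\<omega> * pi) * antideriv (\<lambda>s. cos (\<omega> * s) * f s) pi
     + sin (\<omega> * pi) * antideriv (\<lambda>s. sin (\<omega> * s) * f s) pi) / (\<omega> * sin (\<omega> * pi))"

text \<open>Variation of constants for \<open>a'' + \<omega>\<^sup>2 a = f\<close>. There is no free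
  sine term, so the derivative vanishes at \<open>0\<close> and even \<open>f\<close> give even
  solutions.\<close>

definition osc :: "real \<Rightarrow> (real \<Rightarrow> real) \<Rightarrow> real \<Rightarrow> real" where
  "osc \<omega> f t = osc_coeff \<omega> f * cos (\<omega> * t)
     + (sin (\<omega> * t) * antideriv (\<lambda>s. cos (\<omega> * s) * f s) t
        - cos (\<omega> * t) * antideriv (\<lambda>s. sin (\<omega> * s) * f s) t) / \<omega>"

text \<open>In the derivative of \<open>osc\<close>, the terms that differentiate the two
  antiderivatives cancel.\<close>

definition osc' :: "real \<Rightarrow> (real \<Rightarrow> real) \<Rightarrow> real \<Rightarrow> real" where
  "osc' \<omega> f t = - osc_coeff \<omega> f * \<omega> * sin (\<omega> * t)
     + cos (\<omega> * t) * antideriv (\<lambda>s. cos (\<omega> * s) * f s) t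
     + sin (\<omega> * t) * antideriv (\<lambda>s. sin (\<omega> * s) * f s) t"

lemma osc_diff:
  assumes "continuous_on UNIV f" "continuous_on UNIV g"
  shows "osc \<omega> (\<lambda>s. f s - g s) t = osc \<omega> f t - osc \<omega> g t"
proof -
  have C: "antideriv (\<lambda>s. cos (\<omega> * s) * (f s - g s)) t =
        antideriv (\<lambda>s. cos (\<omega> * s) * f s) t - antideriv (\<lambda>s. cos (\<omega> * s) * g s) t" for t
    unfolding right_diff_distrib by (intro antideriv_diff continuous_intros assms)
  have S: "antideriv (\<lambda>s. sin (\<omega> * s) * (f s - g s)) t =
        antideriv (\<lambda>s. sin (\<omega> * s) * f s) t - antideriv (\<lambda>s. sin (\<omega> * s) * g s) t" for t
    unfolding right_diff_distrib by (intro antideriv_diff continuous_intros assms)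
  show ?thesis
    unfolding osc_def osc_coeff_def C S
    by (simp add: algebra_simps diff_divide_distrib add_divide_distrib)
qed

context
  fixes \<omega> :: real and f :: "real \<Rightarrow> real"
  assumes \<omega>: "\<omega> > 0" "sin (\<omega> * pi) \<noteq> 0"
    and cont: "continuous_on UNIV f" and even: "\<And>t. f (- t) = f t"
begin

lemma DERIV_osc: "(osc \<omega> f has_real_derivative osc' \<omega> f t) (at t)"
proof -
  have "continuous_on UNIV (\<lambda>s. cos (\<omega> * s) * f s)" "continuous_on UNIV (\<lambda>s. sin (\<omega> * s) * f s)"
    by (intro continuous_intros cont)+
  with \<omega> show ?thesis
    unfolding osc_def [abs_def] osc'_def
    by (auto intro!: derivative_eq_intros simp: field_simps)
qed

lemma DERIV_osc': "(osc' \<omega> f has_real_derivative f t - \<omega>\<^sup>2 * osc \<omega> f t) (at t)"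
proof -
  have *: "continuous_on UNIV (\<lambda>s. cos (\<omega> * s) * f s)" "continuous_on UNIV (\<lambda>s. sin (\<omega> * s) * f s)"
    by (intro continuous_intros cont)+
  have eq: "cos (\<omega> * t) * (cos (\<omega> * t) * f t) + sin (\<omega> * t) * (sin (\<omega> * t) * f t) = f t"
    using sin_cos_squared_add3 [of "\<omega> * t"] by (simp add: distrib_right [symmetric] mult.assoc [symmetric])
  show ?thesis
    unfolding osc'_def [abs_def] osc_def
    apply (rule derivative_eq_intros * refl)+
    using \<omega> eq by (simp add: power2_eq_square field_simps) (metis distrib_left)
qed

lemma continuous_on_osc: "continuous_on A (osc \<omega> f)"
  by (meson DERIV_osc DERIV_isCont continuous_at_imp_continuous_on)

lemma osc'_0: "osc' \<omega> f 0 = 0"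
  by (simp add: osc'_def)

lemma osc'_pi: "osc' \<omega> f pi = 0"
  using \<omega> by (simp add: osc'_def osc_coeff_def field_simps)

lemma antideriv_cos_sin_minus:
  "antideriv (\<lambda>s. cos (\<omega> * s) * f s) (- t) = - antideriv (\<lambda>s. cos (\<omega> * s) * f s) t"
  "antideriv (\<lambda>s. sin (\<omega> * s) * f s) (- t) = antideriv (\<lambda>s. sin (\<omega> * s) * f s) t"
  by (rule antideriv_even antideriv_odd; use even in \<open>auto intro!: continuous_intros cont\<close>)+

lemma osc_minus: "osc \<omega> f (- t) = osc \<omega> f t"
  by (simp add: osc_def antideriv_cos_sin_minus)

lemma osc'_minus: "osc' \<omega> f (- t) = - osc' \<omega> f t"
  by (simp add: osc'_def antideriv_cos_sin_minus)

text \<open>The difference between the shifted and the original solution solves the homogeneous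
  oscillator. At \<open>- pi\<close> its value vanishes by evenness, its derivative because
  \<open>osc'\<close> is zero at both \<open>pi\<close> and \<open>- pi\<close>.\<close>

lemma osc_periodic:
  assumes "\<And>t. f (t + 2 * pi) = f t"
  shows "osc \<omega> f (t + 2 * pi) = osc \<omega> f t"
proof -
  have "osc \<omega> f (t + 2 * pi) - osc \<omega> f t = 0"
  proof (rule harmonic_unique [of \<omega> "\<lambda>t. osc \<omega> f (t + 2 * pi) - osc \<omega> f t"
        "\<lambda>t. osc' \<omega> f (t + 2 * pi) - osc' \<omega> f t" "- pi"])
    fix t
    show "((\<lambda>t. osc \<omega> f (t + 2 * pi) - osc \<omega> f t) has_real_derivative
        osc' \<omega> f (t + 2 * pi) - osc' \<omega> f t) (at t)"
      using DERIV_shift DERIV_osc by (intro derivative_intros) blast+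
    show "((\<lambda>t. osc' \<omega> f (t + 2 * pi) - osc' \<omega> f t) has_real_derivative
        - \<omega>\<^sup>2 * (osc \<omega> f (t + 2 * pi) - osc \<omega> f t)) (at t)"
      by (rule DERIV_cong [OF DERIV_diff [OF iffD1 [OF DERIV_shift DERIV_osc' [of "t + 2 * pi"]] DERIV_osc']])
         (simp add: assms right_diff_distrib)
  qed (use \<omega> osc_minus [of pi] osc'_minus [of pi] osc'_pi in auto)
  then show ?thesis by simp
qed

text \<open>Integrate the oscillator equation over half a period: the derivative of the solution is
  zero at both ends. This gives the mean of the solution without its explicit form.\<close>

lemma antideriv_osc_pi: "\<omega>\<^sup>2 * antideriv (osc \<omega> f) pi = antideriv f pi"
proof -
  have "antideriv f pi = osc' \<omega> f pi + \<omega>\<^sup>2 * antideriv (osc \<omega> f) pi"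
    by (rule antideriv_unique)
       (auto intro!: derivative_eq_intros DERIV_osc' continuous_on_osc cont simp: osc'_0)
  then show ?thesis by (simp add: osc'_pi)
qed

text \<open>The two terms of the constant bound the cosine term and the variation-of-constants
  integral. The small divisor \<open>sin (\<omega> * pi)\<close> comes from \<open>osc_coeff\<close>
  and measures the distance to resonance, that is, to integer \<open>\<omega>\<close>.\<close>

lemma osc_bound:
  assumes "\<And>t. f (t + 2 * pi) = f t" "\<And>t. \<bar>f t\<bar> \<le> B"
  shows "\<bar>osc \<omega> f t\<bar> \<le> (4 * pi / (\<omega> * \<bar>sin (\<omega> * pi)\<bar>) + 4 * pi / \<omega>) * B"
proof -
  have "0 \<le> B" using assms(2)[of 0] by linarith
  have cs: "\<bar>cos (\<omega> * s) * f s\<bar> \<le> B" "\<bar>sin (\<omega> * s) * f s\<bar> \<le> B" for s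
    using mult_mono [of "\<bar>cos (\<omega> * s)\<bar>" 1 "\<bar>f s\<bar>" B] mult_mono [of "\<bar>sin (\<omega> * s)\<bar>" 1 "\<bar>f s\<bar>" B] assms(2)[of s]
    by (auto simp: abs_mult)
  have ad: "\<bar>antideriv (\<lambda>s. cos (\<omega> * s) * f s) t\<bar> \<le> 2 * pi * B"
           "\<bar>antideriv (\<lambda>s. sin (\<omega> * s) * f s) t\<bar> \<le> 2 * pi * B" if "t \<in> {0..2 * pi}" for t
  proof -
    have "B * \<bar>t\<bar> \<le> B * (2 * pi)" using that \<open>0 \<le> B\<close> by (intro mult_left_mono) auto
    moreover have "\<bar>antideriv (\<lambda>s. cos (\<omega> * s) * f s) t\<bar> \<le> B * \<bar>t\<bar>"
      "\<bar>antideriv (\<lambda>s. sin (\<omega> * s) * f s) t\<bar> \<le> B * \<bar>t\<bar>"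
      by (rule antideriv_bound; auto intro!: continuous_intros cont cs)+
    ultimately show "\<bar>antideriv (\<lambda>s. cos (\<omega> * s) * f s) t\<bar> \<le> 2 * pi * B"
           "\<bar>antideriv (\<lambda>s. sin (\<omega> * s) * f s) t\<bar> \<le> 2 * pi * B"
      by (simp_all add: mult.commute mult.left_commute)
  qed
  have cosle: "\<bar>cos x * y\<bar> \<le> \<bar>y\<bar>" "\<bar>sin x * y\<bar> \<le> \<bar>y\<bar>" for x y :: real
    by (simp_all add: abs_mult mult_left_le_one_le)
  obtain s where s: "s \<in> {0..2 * pi}" "osc \<omega> f t = osc \<omega> f s"
    using periodic_reduce [of "osc \<omega> f" t] osc_periodic [OF assms(1)] by blast
  let ?C = "antideriv (\<lambda>s. cos (\<omega> * s) * f s)" and ?S = "antideriv (\<lambda>s. sin (\<omega> * s) * f s)"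
  have "\<bar>cos (\<omega> * pi) * ?C pi + sin (\<omega> * pi) * ?S pi\<bar> \<le> 4 * pi * B"
    using cosle(1)[of "\<omega> * pi" "?C pi"] cosle(2)[of "\<omega> * pi" "?S pi"] ad[of pi] by auto
  then have "\<bar>osc_coeff \<omega> f\<bar> \<le> 4 * pi * B / (\<omega> * \<bar>sin (\<omega> * pi)\<bar>)"
    using \<omega> by (auto simp: osc_coeff_def abs_mult intro!: divide_right_mono)
  then have 1: "\<bar>osc_coeff \<omega> f * cos (\<omega> * s)\<bar> \<le> 4 * pi * B / (\<omega> * \<bar>sin (\<omega> * pi)\<bar>)"
    using cosle(1)[of "\<omega> * s" "osc_coeff \<omega> f"] by (simp add: mult.commute)
  have "\<bar>sin (\<omega> * s) * ?C s - cos (\<omega> * s) * ?S s\<bar> \<le> 4 * pi * B"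
    using cosle(2)[of "\<omega> * s" "?C s"] cosle(1)[of "\<omega> * s" "?S s"] ad[of s] s by linarith
  then have "\<bar>(sin (\<omega> * s) * ?C s - cos (\<omega> * s) * ?S s) / \<omega>\<bar> \<le> 4 * pi * B / \<omega>"
    using \<omega> by (auto simp: intro!: divide_right_mono)
  with 1 have "\<bar>osc \<omega> f s\<bar> \<le> 4 * pi * B / (\<omega> * \<bar>sin (\<omega> * pi)\<bar>) + 4 * pi * B / \<omega>"
    unfolding osc_def by linarith
  with s show ?thesis by (simp add: algebra_simps)
qed

end

subsection \<open>The linearized equation in rotating coordinates\<close>

text \<open>Real parts are even and imaginary parts odd. This excludes the constant
  \<open>\<i>\<close>, the infinitesimal phase rotation, which lies in the kernel of the linear
  part.\<close>

definition sym_periodic :: "(real \<Rightarrow> complex) set" where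
  "sym_periodic = {f. continuous_on UNIV f \<and> (\<forall>t. f (t + 2 * pi) = f t) \<and> (\<forall>t. f (- t) = cnj (f t))}"

text \<open>With \<open>w = a + \<i>b\<close>, the imaginary part of \<open>w'' + 2\<i>k w' = f + \<gamma> Re w\<close>
  integrates to \<open>b' + 2ka = h\<close>, and the real part becomes \<open>a'' + \<omega>\<^sup>2 a = Re f + 2kh\<close> with
  \<open>\<omega>\<^sup>2 = 4k\<^sup>2 - \<gamma>\<close>. The integration constant in \<open>h\<close> is the one that makes \<open>b\<close> periodic.\<close>

definition lin_mom :: "real \<Rightarrow> real \<Rightarrow> (real \<Rightarrow> complex) \<Rightarrow> real \<Rightarrow> real" where
  "lin_mom k \<omega> f t = antideriv (\<lambda>s. Im (f s)) t
     + (2 * k / (\<omega>\<^sup>2 - 4 * k\<^sup>2) * antideriv (\<lambda>s. Re (f s)) pi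
        - antideriv (antideriv (\<lambda>s. Im (f s))) pi) / pi"

definition lin_rad :: "real \<Rightarrow> real \<Rightarrow> (real \<Rightarrow> complex) \<Rightarrow> real \<Rightarrow> real" where
  "lin_rad k \<omega> f = osc \<omega> (\<lambda>t. Re (f t) + 2 * k * lin_mom k \<omega> f t)"

definition lin_tan :: "real \<Rightarrow> real \<Rightarrow> (real \<Rightarrow> complex) \<Rightarrow> real \<Rightarrow> real" where
  "lin_tan k \<omega> f = antideriv (\<lambda>t. lin_mom k \<omega> f t - 2 * k * lin_rad k \<omega> f t)"

definition lin_sol :: "real \<Rightarrow> real \<Rightarrow> (real \<Rightarrow> complex) \<Rightarrow> real \<Rightarrow> complex" where
  "lin_sol k \<omega> f t = Complex (lin_rad k \<omega> f t) (lin_tan k \<omega> f t)"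

definition lin_vel :: "real \<Rightarrow> real \<Rightarrow> (real \<Rightarrow> complex) \<Rightarrow> real \<Rightarrow> complex" where
  "lin_vel k \<omega> f t = Complex (osc' \<omega> (\<lambda>t. Re (f t) + 2 * k * lin_mom k \<omega> f t) t)
     (lin_mom k \<omega> f t - 2 * k * lin_rad k \<omega> f t)"

context
  fixes k \<omega> :: real
  assumes \<omega>: "\<omega> > 0" "sin (\<omega> * pi) \<noteq> 0" and res: "\<omega>\<^sup>2 \<noteq> 4 * k\<^sup>2"
begin

context
  fixes f :: "real \<Rightarrow> complex"
  assumes f: "f \<in> sym_periodic"
begin

lemma sym_periodic_parts:
  shows "continuous_on UNIV (\<lambda>s. Re (f s))" "continuous_on UNIV (\<lambda>s. Im (f s))"
    "Re (f (t + 2 * pi)) = Re (f t)" "Im (f (t + 2 * pi)) = Im (f t)"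
    "Re (f (- t)) = Re (f t)" "Im (f (- t)) = - Im (f t)"
  using f by (auto simp: sym_periodic_def intro!: continuous_intros)

text \<open>\<open>Im f\<close> is odd, so its antiderivative is even and the boundary condition for
  periodicity holds automatically. The integration constant stays free for
  \<open>lin_tan_pi\<close>.\<close>

lemma antideriv_Im:
  "antideriv (\<lambda>s. Im (f s)) (- t) = antideriv (\<lambda>s. Im (f s)) t"
  "antideriv (\<lambda>s. Im (f s)) (t + 2 * pi) = antideriv (\<lambda>s. Im (f s)) t"
proof -
  show *: "antideriv (\<lambda>s. Im (f s)) (- t) = antideriv (\<lambda>s. Im (f s)) t" for t
    by (rule antideriv_odd) (auto intro: sym_periodic_parts)
  show "antideriv (\<lambda>s. Im (f s)) (t + 2 * pi) = antideriv (\<lambda>s. Im (f s)) t"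
    by (rule antideriv_periodic) (auto intro: sym_periodic_parts *)
qed

lemma lin_mom:
  "(lin_mom k \<omega> f has_real_derivative Im (f t)) (at t)" "continuous_on A (lin_mom k \<omega> f)"
  "lin_mom k \<omega> f (- t) = lin_mom k \<omega> f t" "lin_mom k \<omega> f (t + 2 * pi) = lin_mom k \<omega> f t"
proof -
  show *: "(lin_mom k \<omega> f has_real_derivative Im (f t)) (at t)" for t
    unfolding lin_mom_def [abs_def]
    by (rule derivative_eq_intros DERIV_antideriv sym_periodic_parts refl | simp)+
  show "continuous_on A (lin_mom k \<omega> f)"
    by (meson * DERIV_isCont continuous_at_imp_continuous_on)
qed (simp_all only: lin_mom_def antideriv_Im)

lemma lin_input:
  shows "continuous_on UNIV (\<lambda>t. Re (f t) + 2 * k * lin_mom k \<omega> f t)"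
    "Re (f (- t)) + 2 * k * lin_mom k \<omega> f (- t) = Re (f t) + 2 * k * lin_mom k \<omega> f t"
    "Re (f (t + 2 * pi)) + 2 * k * lin_mom k \<omega> f (t + 2 * pi) = Re (f t) + 2 * k * lin_mom k \<omega> f t"
  by (auto intro!: continuous_intros lin_mom sym_periodic_parts
      simp only: lin_mom sym_periodic_parts)

lemma lin_rad:
  "continuous_on A (lin_rad k \<omega> f)"
  "lin_rad k \<omega> f (- t) = lin_rad k \<omega> f t" "lin_rad k \<omega> f (t + 2 * pi) = lin_rad k \<omega> f t"
  unfolding lin_rad_def
  by (rule continuous_on_osc osc_minus osc_periodic \<omega> lin_input)+

lemma lin_tan_input:
  shows "continuous_on UNIV (\<lambda>t. lin_mom k \<omega> f t - 2 * k * lin_rad k \<omega> f t)"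
    "lin_mom k \<omega> f (- t) - 2 * k * lin_rad k \<omega> f (- t) = lin_mom k \<omega> f t - 2 * k * lin_rad k \<omega> f t"
    "lin_mom k \<omega> f (t + 2 * pi) - 2 * k * lin_rad k \<omega> f (t + 2 * pi)
      = lin_mom k \<omega> f t - 2 * k * lin_rad k \<omega> f t"
  by (auto intro!: continuous_intros lin_mom lin_rad simp only: lin_mom lin_rad)

text \<open>By \<open>antideriv_osc_pi\<close> the mean of the radial part is affine in the
  integration constant \<open>c\<close>. The requirement is therefore a linear equation for
  \<open>c\<close> with coefficient proportional to \<open>\<omega>\<^sup>2 - 4 * k\<^sup>2\<close>,
  nonzero by \<open>res\<close>, and \<open>c\<close> was defined as its solution.\<close>

lemma lin_tan_pi: "lin_tan k \<omega> f pi = 0"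
proof -
  define H where "H = antideriv (\<lambda>s. Im (f s))"
  define c where "c = (2 * k / (\<omega>\<^sup>2 - 4 * k\<^sup>2) * antideriv (\<lambda>s. Re (f s)) pi - antideriv H pi) / pi"
  have contH: "continuous_on UNIV H"
    unfolding H_def by (intro continuous_intros sym_periodic_parts)
  have mom: "lin_mom k \<omega> f t = H t + c" for t
    by (simp add: lin_mom_def H_def c_def)
  have tan: "lin_tan k \<omega> f pi = antideriv H pi + c * pi - 2 * k * antideriv (lin_rad k \<omega> f) pi"
    unfolding lin_tan_def mom
    by (rule antideriv_unique)
       (auto intro!: derivative_eq_intros DERIV_antideriv contH lin_rad continuous_intros)
  have input: "antideriv (\<lambda>t. Re (f t) + 2 * k * lin_mom k \<omega> f t) pi
      = antideriv (\<lambda>s. Re (f s)) pi + 2 * k * antideriv H pi + 2 * k * c * pi"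
    unfolding mom
    by (rule antideriv_unique)
       (auto intro!: derivative_eq_intros DERIV_antideriv contH sym_periodic_parts continuous_intros
         simp: algebra_simps)
  have "\<omega>\<^sup>2 * antideriv (lin_rad k \<omega> f) pi = antideriv (\<lambda>t. Re (f t) + 2 * k * lin_mom k \<omega> f t) pi"
    unfolding lin_rad_def by (intro antideriv_osc_pi \<omega> lin_input)
  then have osc: "\<omega>\<^sup>2 * antideriv (lin_rad k \<omega> f) pi
      = antideriv (\<lambda>s. Re (f s)) pi + 2 * k * antideriv H pi + 2 * k * c * pi"
    unfolding input .
  have "\<omega>\<^sup>2 * lin_tan k \<omega> f pi
      = \<omega>\<^sup>2 * (antideriv H pi + c * pi) - 2 * k * (\<omega>\<^sup>2 * antideriv (lin_rad k \<omega> f) pi)"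
    unfolding tan by (simp add: algebra_simps)
  also have "\<dots> = (\<omega>\<^sup>2 - 4 * k\<^sup>2) * (antideriv H pi + c * pi) - 2 * k * antideriv (\<lambda>s. Re (f s)) pi"
    unfolding osc by (simp add: algebra_simps power2_eq_square)
  also have "c * pi = 2 * k / (\<omega>\<^sup>2 - 4 * k\<^sup>2) * antideriv (\<lambda>s. Re (f s)) pi - antideriv H pi"
    by (simp add: c_def)
  finally show ?thesis using \<omega> res by simp
qed

lemma lin_tan_minus: "lin_tan k \<omega> f (- t) = - lin_tan k \<omega> f t"
  unfolding lin_tan_def by (rule antideriv_even) (rule lin_tan_input)+

text \<open>An odd function that vanishes at \<open>pi\<close> vanishes at \<open>- pi\<close>; this
  is the mean-zero condition under which the tangential part is periodic.\<close>

lemma lin_tan_boundary: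
  "antideriv (\<lambda>t. lin_mom k \<omega> f t - 2 * k * lin_rad k \<omega> f t) (- pi)
    = antideriv (\<lambda>t. lin_mom k \<omega> f t - 2 * k * lin_rad k \<omega> f t) pi"
  using lin_tan_minus [of pi] lin_tan_pi by (simp add: lin_tan_def)

lemma lin_tan_periodic: "lin_tan k \<omega> f (t + 2 * pi) = lin_tan k \<omega> f t"
  unfolding lin_tan_def by (rule antideriv_periodic lin_tan_input lin_tan_boundary)+

text \<open>Differentiating \<open>b' = h - 2ka\<close> gives the imaginary part of the equation;
  inserting \<open>h = b' + 2ka\<close> into the oscillator equation for \<open>a\<close> gives the
  real part.\<close>

lemma lin_sol_derivs:
  "(lin_sol k \<omega> f has_vector_derivative lin_vel k \<omega> f t) (at t)"
  "(lin_vel k \<omega> f has_vector_derivative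
     f t - 2 * \<i> * k * lin_vel k \<omega> f t + of_real ((4 * k\<^sup>2 - \<omega>\<^sup>2) * Re (lin_sol k \<omega> f t))) (at t)"
proof -
  have rad: "(lin_rad k \<omega> f has_real_derivative Re (lin_vel k \<omega> f t)) (at t)"
    unfolding lin_rad_def lin_vel_def complex.sel by (intro DERIV_osc \<omega> lin_input)
  moreover have "(lin_tan k \<omega> f has_real_derivative Im (lin_vel k \<omega> f t)) (at t)"
    unfolding lin_tan_def lin_vel_def complex.sel by (intro DERIV_antideriv lin_tan_input)
  ultimately show "(lin_sol k \<omega> f has_vector_derivative lin_vel k \<omega> f t) (at t)"
    by (simp add: has_vector_derivative_complex_iff lin_sol_def)
  have "((\<lambda>t. Re (lin_vel k \<omega> f t)) has_real_derivative
      (Re (f t) + 2 * k * lin_mom k \<omega> f t) - \<omega>\<^sup>2 * lin_rad k \<omega> f t) (at t)"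
    unfolding lin_rad_def lin_vel_def complex.sel by (intro DERIV_osc' \<omega> lin_input)
  moreover have "((\<lambda>t. Im (lin_vel k \<omega> f t)) has_real_derivative
      Im (f t) - 2 * k * Re (lin_vel k \<omega> f t)) (at t)"
    unfolding lin_vel_def complex.sel using rad
    by (auto intro!: derivative_eq_intros lin_mom simp: lin_vel_def)
  ultimately show "(lin_vel k \<omega> f has_vector_derivative
     f t - 2 * \<i> * k * lin_vel k \<omega> f t + of_real ((4 * k\<^sup>2 - \<omega>\<^sup>2) * Re (lin_sol k \<omega> f t))) (at t)"
    by (simp add: has_vector_derivative_complex_iff lin_sol_def lin_vel_def algebra_simps power2_eq_square)
qed

lemma lin_sol_sym_periodic: "lin_sol k \<omega> f \<in> sym_periodic"
proof -
  have "continuous_on UNIV (lin_sol k \<omega> f)"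
    by (meson lin_sol_derivs has_vector_derivative_continuous continuous_at_imp_continuous_on)
  then show ?thesis
    by (simp add: sym_periodic_def lin_sol_def lin_tan_periodic lin_tan_minus lin_rad complex_eq_iff)
qed

end

text \<open>Together with \<open>lin_sol_bound\<close> this turns a Lipschitz bound on the
  right-hand side into one on the solution.\<close>

lemma lin_sol_diff:
  assumes f: "f \<in> sym_periodic" and g: "g \<in> sym_periodic"
  shows "lin_sol k \<omega> (\<lambda>s. f s - g s) t = lin_sol k \<omega> f t - lin_sol k \<omega> g t"
proof -
  note fp = sym_periodic_parts [OF f] and gp = sym_periodic_parts [OF g]
  have Re: "antideriv (\<lambda>s. Re (f s - g s)) t = antideriv (\<lambda>s. Re (f s)) t - antideriv (\<lambda>s. Re (g s)) t" for t
    unfolding minus_complex.sel by (intro antideriv_diff fp gp)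
  have Im: "antideriv (\<lambda>s. Im (f s - g s)) t = antideriv (\<lambda>s. Im (f s)) t - antideriv (\<lambda>s. Im (g s)) t" for t
    unfolding minus_complex.sel by (intro antideriv_diff fp gp)
  have Im2: "antideriv (antideriv (\<lambda>s. Im (f s - g s))) t
      = antideriv (antideriv (\<lambda>s. Im (f s))) t - antideriv (antideriv (\<lambda>s. Im (g s))) t" for t
    unfolding Im by (intro antideriv_diff continuous_intros fp gp)
  have mom: "lin_mom k \<omega> (\<lambda>s. f s - g s) t = lin_mom k \<omega> f t - lin_mom k \<omega> g t" for t
    unfolding lin_mom_def Re Im Im2 by (simp add: right_diff_distrib diff_divide_distrib)
  have "(\<lambda>t. Re (f t - g t) + 2 * k * lin_mom k \<omega> (\<lambda>s. f s - g s) t)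
      = (\<lambda>t. (Re (f t) + 2 * k * lin_mom k \<omega> f t) - (Re (g t) + 2 * k * lin_mom k \<omega> g t))"
    by (simp add: mom algebra_simps)
  then have rad: "lin_rad k \<omega> (\<lambda>s. f s - g s) t = lin_rad k \<omega> f t - lin_rad k \<omega> g t" for t
    unfolding lin_rad_def by (simp only: osc_diff lin_input f g)
  have "(\<lambda>t. lin_mom k \<omega> (\<lambda>s. f s - g s) t - 2 * k * lin_rad k \<omega> (\<lambda>s. f s - g s) t)
      = (\<lambda>t. (lin_mom k \<omega> f t - 2 * k * lin_rad k \<omega> f t) - (lin_mom k \<omega> g t - 2 * k * lin_rad k \<omega> g t))"
    by (simp add: mom rad algebra_simps)
  then have "lin_tan k \<omega> (\<lambda>s. f s - g s) t = lin_tan k \<omega> f t - lin_tan k \<omega> g t" for t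
    unfolding lin_tan_def by (simp only: antideriv_diff lin_tan_input f g)
  with rad show ?thesis by (simp add: lin_sol_def complex_eq_iff)
qed

text \<open>The constants follow the construction: \<open>C1\<close> bounds \<open>lin_mom\<close>
  (\<open>2 * pi\<close> for the antiderivative, \<open>2 * pi\<close> and \<open>c\<close> for the
  integration constant), \<open>C2\<close> bounds \<open>lin_rad\<close> through
  \<open>osc_bound\<close>, and \<open>C3\<close> bounds \<open>lin_tan\<close> over one
  period.\<close>

lemma lin_sol_bound:
  obtains M where "M > 0"
    "\<And>f B t. f \<in> sym_periodic \<Longrightarrow> (\<And>t. norm (f t) \<le> B) \<Longrightarrow> norm (lin_sol k \<omega> f t) \<le> M * B"
proof -
  define c where "c = \<bar>2 * k / (\<omega>\<^sup>2 - 4 * k\<^sup>2)\<bar>"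
  define C1 where "C1 = 4 * pi + c"
  define C2 where "C2 = (4 * pi / (\<omega> * \<bar>sin (\<omega> * pi)\<bar>) + 4 * pi / \<omega>) * (1 + 2 * \<bar>k\<bar> * C1)"
  define C3 where "C3 = 2 * pi * (C1 + 2 * \<bar>k\<bar> * C2)"
  have "c \<ge> 0" by (simp add: c_def)
  then have "C1 > 0" unfolding C1_def by (simp add: add_pos_nonneg)
  moreover from this \<omega> have "C2 > 0"
    unfolding C2_def by (intro mult_pos_pos add_pos_pos add_pos_nonneg divide_pos_pos) auto
  ultimately have "C3 > 0"
    unfolding C3_def by (intro mult_pos_pos add_pos_nonneg) auto
  note nonneg = \<open>c \<ge> 0\<close> \<open>C1 > 0\<close> \<open>C2 > 0\<close> \<open>C3 > 0\<close>
  have "norm (lin_sol k \<omega> f t) \<le> (C2 + C3) * B"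
    if f: "f \<in> sym_periodic" and B: "\<And>t. norm (f t) \<le> B" for f B t
  proof -
    note fp = sym_periodic_parts [OF f]
    have Re: "\<bar>Re (f t)\<bar> \<le> B" and Im: "\<bar>Im (f t)\<bar> \<le> B" for t
      using B[of t] abs_Re_le_cmod[of "f t"] abs_Im_le_cmod[of "f t"] by linarith+
    let ?H = "antideriv (\<lambda>s. Im (f s))"
    have H: "\<bar>?H t\<bar> \<le> 2 * pi * B" for t
      by (rule antideriv_periodic_bound) (auto intro: fp Im antideriv_Im [OF f])
    have "\<bar>antideriv (\<lambda>s. Re (f s)) pi\<bar> \<le> B * \<bar>pi\<bar>"
      by (rule antideriv_bound) (auto intro: fp Re)
    then have "\<bar>2 * k / (\<omega>\<^sup>2 - 4 * k\<^sup>2) * antideriv (\<lambda>s. Re (f s)) pi\<bar> \<le> c * (B * pi)"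
      unfolding abs_mult c_def [symmetric] using nonneg by (intro mult_left_mono) auto
    moreover have "\<bar>antideriv ?H pi\<bar> \<le> 2 * pi * B * \<bar>pi\<bar>"
      by (rule antideriv_bound) (auto intro: H continuous_intros fp)
    ultimately have "\<bar>2 * k / (\<omega>\<^sup>2 - 4 * k\<^sup>2) * antideriv (\<lambda>s. Re (f s)) pi - antideriv ?H pi\<bar>
        \<le> c * (B * pi) + 2 * pi * B * \<bar>pi\<bar>"
      by linarith
    then have "\<bar>(2 * k / (\<omega>\<^sup>2 - 4 * k\<^sup>2) * antideriv (\<lambda>s. Re (f s)) pi - antideriv ?H pi) / pi\<bar>
        \<le> c * B + 2 * pi * B"
      unfolding abs_divide by (simp only: abs_of_pos pi_gt_zero pos_divide_le_eq) (simp add: algebra_simps)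
    then have "\<bar>lin_mom k \<omega> f t\<bar> \<le> 2 * pi * B + (c * B + 2 * pi * B)" for t
      unfolding lin_mom_def using H[of t] by linarith
    then have mom: "\<bar>lin_mom k \<omega> f t\<bar> \<le> C1 * B" for t
      unfolding C1_def by (simp add: algebra_simps)
    have kmom: "\<bar>2 * k * lin_mom k \<omega> f t\<bar> \<le> 2 * \<bar>k\<bar> * (C1 * B)" for t
      unfolding abs_mult using mom[of t] by (intro mult_mono) auto
    have "\<bar>Re (f t) + 2 * k * lin_mom k \<omega> f t\<bar> \<le> (1 + 2 * \<bar>k\<bar> * C1) * B" for t
      using kmom[of t] Re[of t] by (simp add: algebra_simps)
    then have rad: "\<bar>lin_rad k \<omega> f t\<bar> \<le> C2 * B" for t
      unfolding lin_rad_def C2_def mult.assoc [of _ _ B]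
      by (intro osc_bound \<omega> lin_input f)
    have krad: "\<bar>2 * k * lin_rad k \<omega> f t\<bar> \<le> 2 * \<bar>k\<bar> * (C2 * B)" for t
      unfolding abs_mult using rad[of t] by (intro mult_mono) auto
    have "\<bar>lin_mom k \<omega> f t - 2 * k * lin_rad k \<omega> f t\<bar> \<le> (C1 + 2 * \<bar>k\<bar> * C2) * B" for t
      using krad[of t] mom[of t] by (simp add: algebra_simps)
    then have "\<bar>lin_tan k \<omega> f t\<bar> \<le> C3 * B"
      \<comment> \<open>The rewriting regroups the bound as \<open>2 * pi\<close> times a bound of
        the integrand, the shape of \<open>antideriv_periodic_bound\<close>.\<close>
      unfolding lin_tan_def C3_def mult.assoc [of _ _ B] mult.assoc [of 2]
      unfolding mult.assoc [of 2, symmetric]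
      by (intro antideriv_periodic_bound lin_tan_input lin_tan_boundary f)
    with rad[of t] cmod_le[of "lin_sol k \<omega> f t"] show ?thesis
      by (simp add: lin_sol_def algebra_simps)
  qed
  with nonneg show ?thesis by (intro that [of "C2 + C3"]) auto
qed

end

subsection \<open>The homogeneous central field\<close>

text \<open>For \<open>s = \<alpha> + 2\<close> this is the acceleration towards a unit mass at
  relative position \<open>z\<close>.\<close>

definition hfield :: "real \<Rightarrow> complex \<Rightarrow> complex" where
  "hfield s z = z /\<^sub>R norm z powr s"

text \<open>Subtracting \<open>s\<close> times the orthogonal projection of \<open>h\<close> onto
  the line through \<open>z\<close> scales radial displacements by \<open>1 - s\<close> and leaves
  tangential ones unchanged.\<close>

definition hfield_deriv :: "real \<Rightarrow> complex \<Rightarrow> complex \<Rightarrow> complex" where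
  "hfield_deriv s z h = (norm z powr - s) *\<^sub>R (h - (s * (sgn z \<bullet> h)) *\<^sub>R sgn z)"

lemma r3bp_force_hfield:
  "r3bp_force \<alpha> m t z = (1 - m) *\<^sub>R hfield (\<alpha> + 2) (m *\<^sub>R cis t - z)
     - m *\<^sub>R hfield (\<alpha> + 2) ((1 - m) *\<^sub>R cis t + z)"
  by (simp add: r3bp_force_def hfield_def)

text \<open>Rotation equivariance, which permits the passage to rotating coordinates.\<close>

lemma hfield_mult_unit: "norm u = 1 \<Longrightarrow> hfield s (u * z) = u * hfield s z"
  by (simp add: hfield_def norm_mult)

text \<open>Reflection equivariance, the source of the reversibility.\<close>

lemma hfield_cnj: "hfield s (cnj z) = cnj (hfield s z)"
  by (simp add: hfield_def)

lemma norm_hfield: "norm (hfield s z) = norm z powr - s * norm z"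
  by (simp add: hfield_def powr_minus)

lemma hfield_has_derivative:
  assumes "z \<noteq> 0"
  shows "(hfield s has_derivative hfield_deriv s z) (at z within S)"
proof -
  have "hfield s = (\<lambda>z. (norm z powr - s) *\<^sub>R z)"
    by (simp add: hfield_def powr_minus fun_eq_iff)
  moreover have "((\<lambda>z. (norm z powr - s) *\<^sub>R z) has_derivative hfield_deriv s z) (at z)"
    using assms
    by (auto intro!: derivative_eq_intros has_derivative_norm
        simp: hfield_deriv_def fun_eq_iff sgn_div_norm powr_diff inner_commute algebra_simps divide_simps)
  ultimately show ?thesis by (simp add: has_derivative_at_withinI)
qed

lemma continuous_on_hfield: "0 \<notin> S \<Longrightarrow> continuous_on S (hfield s)"
  using hfield_has_derivative by (metis differentiableI differentiable_imp_continuous_on differentiable_on_def)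

lemma norm_hfield_deriv:
  assumes "0 \<le> s"
  shows "norm (hfield_deriv s z h) \<le> (1 + s) * norm z powr - s * norm h"
proof -
  have "\<bar>sgn z \<bullet> h\<bar> * norm (sgn z) \<le> norm h"
  proof (cases "z = 0")
    case False
    then show ?thesis using Cauchy_Schwarz_ineq2 [of "sgn z" h] by (simp add: norm_sgn)
  qed simp
  then have "s * (\<bar>sgn z \<bullet> h\<bar> * norm (sgn z)) \<le> s * norm h"
    using assms by (rule mult_left_mono)
  moreover have "norm ((s * (sgn z \<bullet> h)) *\<^sub>R sgn z) = s * (\<bar>sgn z \<bullet> h\<bar> * norm (sgn z))"
    using assms by (simp add: abs_mult)
  ultimately have "norm (h - (s * (sgn z \<bullet> h)) *\<^sub>R sgn z) \<le> norm h + s * norm h"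
    using norm_triangle_ineq4 [of h "(s * (sgn z \<bullet> h)) *\<^sub>R sgn z"] by linarith
  then have "norm (h - (s * (sgn z \<bullet> h)) *\<^sub>R sgn z) \<le> (1 + s) * norm h"
    by (simp add: algebra_simps)
  then have "norm z powr - s * norm (h - (s * (sgn z \<bullet> h)) *\<^sub>R sgn z) \<le> norm z powr - s * ((1 + s) * norm h)"
    by (intro mult_left_mono) auto
  then show ?thesis by (simp add: hfield_deriv_def mult_ac)
qed

text \<open>Mean value inequality away from the singularity; it will control the pull of the light
  primary.\<close>

lemma hfield_lipschitz:
  assumes "convex S" "0 < c" "\<And>z. z \<in> S \<Longrightarrow> c \<le> norm z" "0 \<le> s" "z \<in> S" "z' \<in> S"
  shows "norm (hfield s z - hfield s z') \<le> (1 + s) * c powr - s * norm (z - z')"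
proof (rule differentiable_bound [OF assms(1) _ _ assms(5,6)])
  fix x assume x: "x \<in> S"
  then show "(hfield s has_derivative hfield_deriv s x) (at x within S)"
    using assms by (intro hfield_has_derivative) force
  have "norm x powr - s \<le> c powr - s"
    using assms x by (intro powr_mono2') auto
  then have "(1 + s) * norm x powr - s \<le> (1 + s) * c powr - s"
    using assms by (intro mult_left_mono) auto
  then show "onorm (hfield_deriv s x) \<le> (1 + s) * c powr - s"
    using assms(4) by (intro onorm_bound order_trans [OF norm_hfield_deriv] mult_right_mono) auto
qed

text \<open>A real-linear map on the complex plane is controlled by its values at \<open>1\<close> and \<open>\<i>\<close>, so
  pointwise continuity of the derivative there suffices.\<close>

lemma strictly_differentiable_complex:
  fixes f :: "complex \<Rightarrow> complex"
  assumes S: "open S" "z0 \<in> S" and der: "\<And>z. z \<in> S \<Longrightarrow> (f has_derivative D z) (at z)"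
    and cont: "isCont (\<lambda>z. D z 1) z0" "isCont (\<lambda>z. D z \<i>) z0" and "\<epsilon> > 0"
  obtains d where "d > 0" "ball z0 d \<subseteq> S"
    "\<And>z z'. z \<in> ball z0 d \<Longrightarrow> z' \<in> ball z0 d \<Longrightarrow>
      norm (f z - f z' - D z0 (z - z')) \<le> \<epsilon> * norm (z - z')"
proof -
  have "\<forall>\<^sub>F z in nhds z0. dist (D z 1) (D z0 1) < \<epsilon> / 2" "\<forall>\<^sub>F z in nhds z0. dist (D z \<i>) (D z0 \<i>) < \<epsilon> / 2"
    using cont \<open>\<epsilon> > 0\<close> unfolding continuous_at_eps_delta eventually_nhds_metric
    by (metis half_gt_zero)+
  moreover have "\<forall>\<^sub>F z in nhds z0. z \<in> S"
    using S by (rule eventually_nhds_in_open)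
  ultimately have "\<forall>\<^sub>F z in nhds z0. dist (D z 1) (D z0 1) < \<epsilon> / 2 \<and> dist (D z \<i>) (D z0 \<i>) < \<epsilon> / 2 \<and> z \<in> S"
    by (intro eventually_conj)
  then obtain d where d: "d > 0" "\<And>z. dist z z0 < d \<Longrightarrow>
      dist (D z 1) (D z0 1) < \<epsilon> / 2 \<and> dist (D z \<i>) (D z0 \<i>) < \<epsilon> / 2 \<and> z \<in> S"
    unfolding eventually_nhds_metric by blast
  show thesis
  proof (rule that [OF d(1)])
    show "ball z0 d \<subseteq> S" using d by (auto simp: dist_commute)
    fix z z' assume z: "z \<in> ball z0 d" "z' \<in> ball z0 d"
    have lin: "linear (D z)" if "z \<in> S" for z
      using der [OF that] by (rule has_derivative_linear)
    \<comment> \<open>The mean value inequality is applied to \<open>f\<close> minus its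
      linearization at \<open>z0\<close>, whose derivative \<open>D x - D z0\<close> is small on the
      ball.\<close>
    have "norm ((f z - D z0 z) - (f z' - D z0 z')) \<le> \<epsilon> * norm (z - z')"
    proof (rule differentiable_bound [OF convex_ball [of z0 d] _ _ z])
      fix x assume "x \<in> ball z0 d"
      then have x: "x \<in> S" "dist (D x 1) (D z0 1) < \<epsilon> / 2" "dist (D x \<i>) (D z0 \<i>) < \<epsilon> / 2"
        using d(2)[of x] by (auto simp: dist_commute)
      show "((\<lambda>z. f z - D z0 z) has_derivative (\<lambda>h. D x h - D z0 h)) (at x within ball z0 d)"
        by (intro has_derivative_diff has_derivative_at_withinI [OF der [OF x(1)]]
            bounded_linear_imp_has_derivative has_derivative_bounded_linear [OF der [OF S(2)]])
      have "norm (D x h - D z0 h) \<le> \<epsilon> * norm h" for h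
      proof -
        have h: "h = Re h *\<^sub>R 1 + Im h *\<^sub>R \<i>"
          by (simp add: complex_eq_iff)
        have lins: "D y h = Re h *\<^sub>R D y 1 + Im h *\<^sub>R D y \<i>" if "y \<in> S" for y
          using lin [OF that] h by (metis linear_add linear_scale)
        have "D x h - D z0 h = Re h *\<^sub>R (D x 1 - D z0 1) + Im h *\<^sub>R (D x \<i> - D z0 \<i>)"
          unfolding lins [OF x(1)] lins [OF S(2)] by (simp add: algebra_simps)
        then have "norm (D x h - D z0 h)
            \<le> \<bar>Re h\<bar> * norm (D x 1 - D z0 1) + \<bar>Im h\<bar> * norm (D x \<i> - D z0 \<i>)"
          using norm_triangle_ineq by (metis norm_scaleR)
        also have "\<dots> \<le> norm h * (\<epsilon> / 2) + norm h * (\<epsilon> / 2)"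
          using x by (intro add_mono mult_mono abs_Re_le_cmod abs_Im_le_cmod) (auto simp: dist_norm)
        finally show ?thesis by (simp add: mult.commute)
      qed
      then show "onorm (\<lambda>h. D x h - D z0 h) \<le> \<epsilon>"
        by (intro onorm_bound) (use \<open>\<epsilon> > 0\<close> in auto)
    qed
    then show "norm (f z - f z' - D z0 (z - z')) \<le> \<epsilon> * norm (z - z')"
      by (simp add: linear_diff [OF lin [OF S(2)]] algebra_simps)
  qed
qed

text \<open>The two-point form makes the remainder after linearization a map with small Lipschitz
  constant, as a contraction needs.\<close>

lemma hfield_strictly_differentiable:
  assumes "z0 \<noteq> 0" "\<epsilon> > 0"
  obtains d where "d > 0" "0 \<notin> ball z0 d"
    "\<And>z z'. z \<in> ball z0 d \<Longrightarrow> z' \<in> ball z0 d \<Longrightarrow>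
      norm (hfield s z - hfield s z' - hfield_deriv s z0 (z - z')) \<le> \<epsilon> * norm (z - z')"
proof (rule strictly_differentiable_complex [of "- {0}" z0 "hfield s" "hfield_deriv s" \<epsilon>])
  show "isCont (\<lambda>z. hfield_deriv s z 1) z0" "isCont (\<lambda>z. hfield_deriv s z \<i>) z0"
    unfolding hfield_deriv_def sgn_div_norm using assms by (auto intro!: continuous_intros)
qed (use assms in \<open>auto intro: hfield_has_derivative that\<close>)

text \<open>In rotating coordinates \<open>- r\<close> is the position of the heavy primary relative
  to the particle on the unperturbed circle. The radial direction is the real axis, whence
  \<open>Re h\<close>.\<close>

lemma hfield_deriv_neg_real:
  assumes "r > 0"
  shows "hfield_deriv s (- of_real r) h = (r powr - s) *\<^sub>R (h - of_real (s * Re h))"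
  using assms by (simp add: hfield_deriv_def sgn_div_norm complex_eq_iff inner_complex_def)

subsection \<open>Solutions of the perturbed equation\<close>

text \<open>Contraction principle for \<open>w = lin_sol (G w)\<close> on a sup-norm ball. The
  Lipschitz constant \<open>1 / (2 * M)\<close> gives the factor \<open>1 / 2\<close>, and the size
  of \<open>G t 0\<close> keeps the ball of radius \<open>\<delta>\<close> invariant.
  \<open>M\<close> is fixed before \<open>\<delta>\<close> and \<open>G\<close>, so these may be
  chosen in terms of it.\<close>

lemma perturbed_linear_solution:
  assumes \<omega>: "\<omega> > 0" "sin (\<omega> * pi) \<noteq> 0" and res: "\<omega>\<^sup>2 \<noteq> 4 * k\<^sup>2"
  obtains M where "M > 0" and
    "\<And>\<delta> G. \<lbrakk>\<delta> > 0;
       \<And>w. w \<in> sym_periodic \<Longrightarrow> (\<And>t. norm (w t) \<le> \<delta>) \<Longrightarrow> (\<lambda>t. G t (w t)) \<in> sym_periodic;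
       \<And>t w w'. norm w \<le> \<delta> \<Longrightarrow> norm w' \<le> \<delta> \<Longrightarrow> norm (G t w - G t w') \<le> norm (w - w') / (2 * M);
       \<And>t. norm (G t 0) \<le> \<delta> / (2 * M)\<rbrakk> \<Longrightarrow>
     \<exists>w v. w \<in> sym_periodic \<and> (\<forall>t. norm (w t) \<le> \<delta>) \<and>
       (\<forall>t. (w has_vector_derivative v t) (at t) \<and>
         (v has_vector_derivative G t (w t) - 2 * \<i> * of_real k * v t
            + of_real ((4 * k\<^sup>2 - \<omega>\<^sup>2) * Re (w t))) (at t))"
proof -
  obtain M where M: "M > 0"
    "\<And>f B t. f \<in> sym_periodic \<Longrightarrow> (\<And>t. norm (f t) \<le> B) \<Longrightarrow> norm (lin_sol k \<omega> f t) \<le> M * B"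
    using lin_sol_bound [OF assms] by blast
  show thesis
  proof (rule that [OF M(1)])
    fix \<delta> :: real and G :: "real \<Rightarrow> complex \<Rightarrow> complex"
    assume \<delta>: "\<delta> > 0"
      and G: "\<And>w. w \<in> sym_periodic \<Longrightarrow> (\<And>t. norm (w t) \<le> \<delta>) \<Longrightarrow> (\<lambda>t. G t (w t)) \<in> sym_periodic"
      and lip: "\<And>t w w'. norm w \<le> \<delta> \<Longrightarrow> norm w' \<le> \<delta> \<Longrightarrow> norm (G t w - G t w') \<le> norm (w - w') / (2 * M)"
      and G0: "\<And>t. norm (G t 0) \<le> \<delta> / (2 * M)"
    define S where "S = {x :: real \<Rightarrow>\<^sub>C complex. apply_bcontfun x \<in> sym_periodic \<and> (\<forall>t. norm (x t) \<le> \<delta>)}"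
    define F where "F x = lin_sol k \<omega> (\<lambda>t. G t (apply_bcontfun x t))" for x :: "real \<Rightarrow>\<^sub>C complex"
    have GS: "(\<lambda>t. G t (apply_bcontfun x t)) \<in> sym_periodic" if "x \<in> S" for x
      using that by (auto simp: S_def intro: G)
    have F_sym: "F x \<in> sym_periodic" if "x \<in> S" for x
      unfolding F_def by (intro lin_sol_sym_periodic assms GS that)
    have F_bound: "norm (F x t) \<le> \<delta>" if "x \<in> S" for x t
    proof -
      have "norm (G t (x t)) \<le> \<delta> / M" for t
      proof -
        have xt: "norm (x t) \<le> \<delta>" using that by (simp add: S_def)
        have "norm (G t (x t)) \<le> norm (G t (x t) - G t 0) + norm (G t 0)"
          by (metis diff_add_cancel norm_triangle_ineq)
        also have "\<dots> \<le> norm (x t) / (2 * M) + \<delta> / (2 * M)"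
          using lip [of "x t" 0 t] G0 [of t] xt \<delta> by simp
        also have "\<dots> \<le> \<delta> / (2 * M) + \<delta> / (2 * M)"
          using xt M(1) by (intro add_mono divide_right_mono) auto
        finally show ?thesis using M(1) by simp
      qed
      from M(2) [OF GS [OF that] this, of t] show ?thesis
        using M(1) by (simp add: F_def)
    qed
    have F_lip: "norm (F x t - F y t) \<le> 1 / 2 * dist x y" if "x \<in> S" "y \<in> S" for x y t
    proof -
      have "norm (G t (x t) - G t (y t)) \<le> dist x y / (2 * M)" for t
      proof -
        have "norm (G t (x t) - G t (y t)) \<le> norm (x t - y t) / (2 * M)"
          using that by (intro lip) (auto simp: S_def)
        also have "\<dots> \<le> dist x y / (2 * M)"
          using M(1) dist_bounded [of x t y] by (intro divide_right_mono) (auto simp: dist_norm)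
        finally show ?thesis .
      qed
      moreover have "(\<lambda>t. G t (x t) - G t (y t)) \<in> sym_periodic"
        using GS [OF that(1)] GS [OF that(2)] by (auto simp: sym_periodic_def intro!: continuous_intros)
      ultimately have "norm (lin_sol k \<omega> (\<lambda>t. G t (x t) - G t (y t)) t) \<le> M * (dist x y / (2 * M))"
        by (intro M(2))
      then show ?thesis
        using M(1) by (simp add: F_def lin_sol_diff [OF assms GS [OF that(1)] GS [OF that(2)]])
    qed
    \<comment> \<open>\<open>Bcontfun\<close> returns to the complete space of bounded continuous
      functions; this is faithful since \<open>F x\<close> is continuous and bounded for
      \<open>x\<close> in \<open>S\<close>.\<close>
    define T where "T x = Bcontfun (F x)" for x
    have T: "apply_bcontfun (T x) = F x" if "x \<in> S" for x
      unfolding T_def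
      by (intro Bcontfun_inverse bcontfun_normI [of _ \<delta>] F_bound that)
         (use F_sym [OF that] in \<open>auto simp: sym_periodic_def\<close>)
    have "closed S"
    proof -
      have cont: "continuous_on UNIV (\<lambda>x :: real \<Rightarrow>\<^sub>C complex. x t)" for t
        by (auto simp: continuous_on_iff intro: le_less_trans [OF dist_bounded])
      \<comment> \<open>Continuity is part of the type, so only pointwise conditions remain, and
        these are closed because evaluation at \<open>t\<close> is continuous.\<close>
      have "S = {x :: real \<Rightarrow>\<^sub>C complex. \<forall>t. x (t + 2 * pi) = x t \<and> x (- t) = cnj (x t) \<and> norm (x t) \<le> \<delta>}"
        by (auto simp: S_def sym_periodic_def)
      also have "closed \<dots>"
        by (intro closed_Collect_all closed_Collect_conj closed_Collect_eq closed_Collect_le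
            continuous_on_cnj continuous_on_norm continuous_on_const cont)
      finally show ?thesis .
    qed
    then have "complete S" by (simp add: complete_eq_closed)
    moreover have "0 \<in> S"
      using \<delta> by (simp add: S_def sym_periodic_def)
    moreover have "T ` S \<subseteq> S"
      using T F_sym F_bound by (auto simp: S_def)
    moreover have "dist (T x) (T y) \<le> 1 / 2 * dist x y" if "x \<in> S" "y \<in> S" for x y
      by (rule dist_bound) (use F_lip that in \<open>simp add: T dist_norm\<close>)
    ultimately obtain x where x: "x \<in> S" "T x = x"
      using Banach_fix [of S "1 / 2" T] by auto
    with T have Fx: "apply_bcontfun x = F x" by metis
    \<comment> \<open>The fixed point is an output of \<open>lin_sol\<close> and so inherits its
      derivatives, although \<open>S\<close> asks only for continuity.\<close>
    have "(F x has_vector_derivative lin_vel k \<omega> (\<lambda>t. G t (x t)) t) (at t) \<and>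
      (lin_vel k \<omega> (\<lambda>t. G t (x t)) has_vector_derivative G t (x t)
         - 2 * \<i> * of_real k * lin_vel k \<omega> (\<lambda>t. G t (x t)) t
         + of_real ((4 * k\<^sup>2 - \<omega>\<^sup>2) * Re (F x t))) (at t)" for t
      unfolding F_def by (intro conjI lin_sol_derivs assms GS x)
    with x Fx show "\<exists>w v. w \<in> sym_periodic \<and> (\<forall>t. norm (w t) \<le> \<delta>) \<and>
       (\<forall>t. (w has_vector_derivative v t) (at t) \<and>
         (v has_vector_derivative G t (w t) - 2 * \<i> * of_real k * v t
            + of_real ((4 * k\<^sup>2 - \<omega>\<^sup>2) * Re (w t))) (at t))"
      unfolding S_def by (smt (verit) mem_Collect_eq)
  qed
qed

section \<open>The nonlinear remainder in rotating coordinates\<close>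

text \<open>The first line is the force divided by \<open>r\<close>, seen in the frame rotating with
  the orbit, where \<open>u\<close> is the direction of the heavy primary. The second line removes
  its value and linearization at \<open>m = 0\<close>, \<open>w = 0\<close>.\<close>

definition nonlin :: "real \<Rightarrow> real \<Rightarrow> real \<Rightarrow> complex \<Rightarrow> complex \<Rightarrow> complex" where
  "nonlin s r m u w =
     ((1 - m) *\<^sub>R hfield s (m *\<^sub>R u - r *\<^sub>R (1 + w)) - m *\<^sub>R hfield s ((1 - m) *\<^sub>R u + r *\<^sub>R (1 + w))) /\<^sub>R r
     + (r powr - s) *\<^sub>R (1 + w - of_real (s * Re w))"

text \<open>No collisions, a small Lipschitz constant and a small initial defect: with
  \<open>\<epsilon> = 1 / (2 * M)\<close> this is what the contraction asks of the
  nonlinearity.\<close>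

definition nonlin_small :: "real \<Rightarrow> real \<Rightarrow> real \<Rightarrow> real \<Rightarrow> real \<Rightarrow> complex \<Rightarrow> bool" where
  "nonlin_small s r \<epsilon> \<delta> m u \<longleftrightarrow>
     (\<forall>w. norm w \<le> \<delta> \<longrightarrow> m *\<^sub>R u - r *\<^sub>R (1 + w) \<noteq> 0 \<and> (1 - m) *\<^sub>R u + r *\<^sub>R (1 + w) \<noteq> 0) \<and>
     (\<forall>w w'. norm w \<le> \<delta> \<longrightarrow> norm w' \<le> \<delta> \<longrightarrow>
        norm (nonlin s r m u w - nonlin s r m u w') \<le> \<epsilon> * norm (w - w')) \<and>
     norm (nonlin s r m u 0) \<le> \<epsilon> * \<delta>"

lemma norm_minus_scaled_Re:
  assumes "0 \<le> s"
  shows "norm (w - of_real (s * Re w)) \<le> (1 + s) * norm w"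
proof -
  have "norm (w - of_real (s * Re w)) \<le> norm w + s * \<bar>Re w\<bar>"
    using norm_triangle_ineq4 [of w "of_real (s * Re w)"] assms by (simp add: abs_mult norm_mult)
  also have "\<dots> \<le> norm w + s * norm w"
    using assms by (intro add_left_mono mult_left_mono abs_Re_le_cmod) auto
  finally show ?thesis by (simp add: algebra_simps)
qed

lemma norm_add_diff_le:
  fixes a b c d :: "'a :: real_normed_vector"
  assumes "norm a \<le> A" "norm b \<le> B" "norm c \<le> C"
  shows "norm (a + b - c) \<le> A + B + C"
  using norm_triangle_ineq4 [of "a + b" c] norm_triangle_ineq [of a b] assms by linarith

text \<open>\<open>\<delta>0\<close> is chosen before \<open>m\<close>, and \<open>m0\<close>
  depends on \<open>\<delta>\<close> but not on \<open>u\<close>, so the bounds are uniform in time.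
  One third of \<open>\<epsilon>\<close> each goes to the remainder of the linearization, to the
  factor \<open>1 - m\<close> in front of the linear part, and to the light primary.\<close>

lemma nonlin_estimate:
  assumes r: "0 < r" "r < 1" and s: "0 \<le> s" and "\<epsilon> > 0"
  obtains \<delta>0 where "\<delta>0 > 0"
    "\<And>\<delta>. 0 < \<delta> \<Longrightarrow> \<delta> \<le> \<delta>0 \<Longrightarrow> \<exists>m0>0. \<forall>m u. 0 < m \<and> m < m0 \<and> norm u = 1 \<longrightarrow>
       nonlin_small s r \<epsilon> \<delta> m u"
proof -
  \<comment> \<open>Half the gap between the circle of radius \<open>r\<close> and the unit circle.
    Giving up \<open>c / 2\<close> for the displacement and \<open>c / 2\<close> for
    \<open>m\<close> leaves distance \<open>c\<close> to the light primary.\<close>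
  define c where "c = (1 - r) / 2"
  have c: "c > 0" using r by (simp add: c_def)
  have "- complex_of_real r \<noteq> 0" "\<epsilon> / 3 > 0" using r \<open>\<epsilon> > 0\<close> by auto
  then obtain d where d: "d > 0" "0 \<notin> ball (- complex_of_real r) d" and strict:
    "\<And>z z'. z \<in> ball (- complex_of_real r) d \<Longrightarrow> z' \<in> ball (- complex_of_real r) d \<Longrightarrow>
      norm (hfield s z - hfield s z' - hfield_deriv s (- of_real r) (z - z')) \<le> \<epsilon> / 3 * norm (z - z')"
    using hfield_strictly_differentiable [of "- complex_of_real r" "\<epsilon> / 3" s] by metis
  define K where "K = r powr - s"
  define L where "L = (1 + s) * c powr - s"
  \<comment> \<open>\<open>m * Q\<close> will bound the remainder at \<open>w = 0\<close>:
    \<open>K\<close> stems from the lost part \<open>m\<close> of the heavy mass, the quotient from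
    the shift of the heavy primary and from the light one.\<close>
  define Q where "Q = K + ((1 + s) * K + \<epsilon> / 3 + c powr - s * 2) / r"
  have pos: "K > 0" "L > 0" "Q > 0"
    using r c s \<open>\<epsilon> > 0\<close> by (auto simp: K_def L_def Q_def intro!: add_pos_pos add_nonneg_pos divide_pos_pos mult_pos_pos)
  \<comment> \<open>The displacement \<open>r * \<delta>\<close> stays below \<open>d / 2\<close>,
    leaving room in the ball for the shift by \<open>m\<close> in \<open>Z\<close>, and below
    \<open>c / 2\<close> for \<open>Y\<close>.\<close>
  define \<delta>0 where "\<delta>0 = min (d / (2 * r)) (c / (2 * r))"
  show thesis
  proof (rule that)
    show "\<delta>0 > 0" using d c r by (simp add: \<delta>0_def)
    fix \<delta> :: real assume \<delta>: "0 < \<delta>" "\<delta> \<le> \<delta>0"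
    then have r\<delta>: "r * \<delta> \<le> d / 2" "r * \<delta> \<le> c / 2"
      using r by (auto simp: \<delta>0_def field_simps)
    \<comment> \<open>The entries give in turn \<open>m < 1\<close>, room for \<open>Z\<close>,
      distance of \<open>Y\<close> from \<open>0\<close>, the two thirds of the Lipschitz constant
      that carry a factor \<open>m\<close>, and the size at \<open>w = 0\<close>.\<close>
    define m0 where "m0 = Min {1, d / 2, c / 2, \<epsilon> / (3 * ((1 + s) * K)), \<epsilon> / (3 * L), \<epsilon> * \<delta> / Q}"
    have "m0 > 0"
      using d c pos s \<open>\<epsilon> > 0\<close> \<delta> by (simp add: m0_def)
    moreover have "nonlin_small s r \<epsilon> \<delta> m u"
      if "0 < m" "m < m0" and u: "norm u = 1" for m u
    proof -
      have m: "0 < m" "m < 1" "m < d / 2" "m < c / 2"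
        and mK: "m < \<epsilon> / (3 * ((1 + s) * K))" and mL: "m < \<epsilon> / (3 * L)" and mQ: "m < \<epsilon> * \<delta> / Q"
        using that by (simp_all add: m0_def)
      have mK: "m * ((1 + s) * K) \<le> \<epsilon> / 3" and mL: "m * L \<le> \<epsilon> / 3" and mQ: "m * Q \<le> \<epsilon> * \<delta>"
      proof -
        have third: "m * X \<le> \<epsilon> / 3" if "m < \<epsilon> / (3 * X)" "X > 0" for X
          using that by (simp add: field_simps)
        show "m * ((1 + s) * K) \<le> \<epsilon> / 3" using pos s by (intro third mK) auto
        show "m * L \<le> \<epsilon> / 3" using pos by (intro third mL)
        show "m * Q \<le> \<epsilon> * \<delta>" using mQ pos by (simp add: field_simps)
      qed
      define Z where "Z w = m *\<^sub>R u - r *\<^sub>R (1 + w)" for w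
      define Y where "Y w = (1 - m) *\<^sub>R u + r *\<^sub>R (1 + w)" for w
      have Z: "Z w \<in> ball (- complex_of_real r) d" if "norm w \<le> \<delta>" for w
      proof -
        have "norm (m *\<^sub>R u - r *\<^sub>R w) \<le> m + r * norm w"
          using norm_triangle_ineq4 [of "m *\<^sub>R u" "r *\<^sub>R w"] m u r by simp
        also have "r * norm w \<le> r * \<delta>" using that r by simp
        finally have "norm (m *\<^sub>R u - r *\<^sub>R w) < d" using m r\<delta> by simp
        moreover have "Z w - (- complex_of_real r) = m *\<^sub>R u - r *\<^sub>R w"
          by (simp add: Z_def algebra_simps scaleR_conv_of_real)
        ultimately show ?thesis
          by (metis dist_commute dist_norm mem_ball)
      qed
      define S where "S = ball ((1 - m) *\<^sub>R u + of_real r) c"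
      have Y: "Y w \<in> cball ((1 - m) *\<^sub>R u + of_real r) (c / 2)" if "norm w \<le> \<delta>" for w
      proof -
        have "norm (r *\<^sub>R w) \<le> r * \<delta>" using that r by simp
        also note r\<delta>(2)
        finally have "norm (r *\<^sub>R w) \<le> c / 2" .
        moreover have "Y w - ((1 - m) *\<^sub>R u + of_real r) = r *\<^sub>R w"
          by (simp add: Y_def algebra_simps scaleR_conv_of_real)
        ultimately show ?thesis
          by (metis dist_commute dist_norm mem_cball)
      qed
      have far: "c \<le> norm y" if "y \<in> cball ((1 - m) *\<^sub>R u + of_real r) (c / 2)" for y
      proof -
        have "norm ((1 - m) *\<^sub>R u) \<le> norm ((1 - m) *\<^sub>R u + of_real r - y) + norm y + norm (complex_of_real r)"
          using norm_triangle_ineq4 [of "(1 - m) *\<^sub>R u + of_real r - y + y" "of_real r"]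
            norm_triangle_ineq [of "(1 - m) *\<^sub>R u + of_real r - y" y]
          by (simp del: norm_scaleR)
        then have "1 - m \<le> c / 2 + norm y + r"
          using that m u r by (simp add: dist_norm)
        moreover have "1 - r = 2 * c" by (simp add: c_def)
        ultimately show ?thesis using m(4) by linarith
      qed
      have split: "nonlin s r m u w = ((1 - m) *\<^sub>R hfield s (Z w) - m *\<^sub>R hfield s (Y w)) /\<^sub>R r
          + K *\<^sub>R (1 + w - of_real (s * Re w))" for w
        by (simp add: nonlin_def Z_def Y_def K_def)
      have "m *\<^sub>R u - r *\<^sub>R (1 + w) \<noteq> 0 \<and> (1 - m) *\<^sub>R u + r *\<^sub>R (1 + w) \<noteq> 0" if "norm w \<le> \<delta>" for w
        using Z [OF that] far [OF Y [OF that]] c d(2) unfolding Z_def Y_def by auto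
      moreover have "norm (nonlin s r m u w - nonlin s r m u w') \<le> \<epsilon> * norm (w - w')"
        if w: "norm w \<le> \<delta>" "norm w' \<le> \<delta>" for w w'
      proof -
        define E where "E = hfield s (Z w) - hfield s (Z w') - hfield_deriv s (- of_real r) (Z w - Z w')"
        define h where "h = (w - w') - of_real (s * Re (w - w'))"
        have Zd: "Z w - Z w' = - (r *\<^sub>R (w - w'))"
          by (simp add: Z_def algebra_simps)
        have D: "hfield_deriv s (- of_real r) (Z w - Z w') = - (r * K) *\<^sub>R h"
          unfolding Zd by (simp add: hfield_deriv_neg_real r K_def h_def algebra_simps complex_eq_iff)
        have "norm E \<le> \<epsilon> / 3 * norm (Z w - Z w')"
          unfolding E_def by (intro strict Z w)
        then have E: "norm E \<le> \<epsilon> / 3 * (r * norm (w - w'))"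
          using r by (simp add: Zd)
        have Ydiff: "norm (hfield s (Y w) - hfield s (Y w')) \<le> L * norm (Y w - Y w')"
          unfolding L_def by (rule hfield_lipschitz [OF convex_cball c far s Y Y]) (use w in auto)
        have "Y w - Y w' = r *\<^sub>R (w - w')" by (simp add: Y_def algebra_simps)
        with Ydiff r have Ydiff: "norm (hfield s (Y w) - hfield s (Y w')) \<le> L * (r * norm (w - w'))"
          by simp
        have ZE: "hfield s (Z w) = hfield s (Z w') + (E - (r * K) *\<^sub>R h)"
          using D by (simp add: E_def)
        \<comment> \<open>The linear part enters as \<open>- (1 - m) * K\<close> from the force and
          \<open>K\<close> from the correction, so only \<open>m * K\<close> survives.\<close>
        have "nonlin s r m u w - nonlin s r m u w' = ((1 - m) / r) *\<^sub>R E + (m * K) *\<^sub>R h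
            - (m / r) *\<^sub>R (hfield s (Y w) - hfield s (Y w'))"
          unfolding split ZE using r
          by (simp add: h_def scaleR_conv_of_real field_simps)
        moreover have "norm (((1 - m) / r) *\<^sub>R E) \<le> \<epsilon> / 3 * norm (w - w')"
        proof -
          have "norm (((1 - m) / r) *\<^sub>R E) \<le> 1 / r * (\<epsilon> / 3 * (r * norm (w - w')))"
            unfolding norm_scaleR using m r by (intro mult_mono E) (auto simp: divide_right_mono)
          then show ?thesis using r by simp
        qed
        moreover have "norm ((m * K) *\<^sub>R h) \<le> \<epsilon> / 3 * norm (w - w')"
        proof -
          have "norm ((m * K) *\<^sub>R h) \<le> (m * K) * ((1 + s) * norm (w - w'))"
            unfolding norm_scaleR h_def using m pos
            by (intro mult_mono norm_minus_scaled_Re s) (auto simp: s)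
          also have "\<dots> = m * ((1 + s) * K) * norm (w - w')" by simp
          also have "\<dots> \<le> \<epsilon> / 3 * norm (w - w')" by (intro mult_right_mono mK) auto
          finally show ?thesis .
        qed
        moreover have "norm ((m / r) *\<^sub>R (hfield s (Y w) - hfield s (Y w'))) \<le> \<epsilon> / 3 * norm (w - w')"
        proof -
          have "norm ((m / r) *\<^sub>R (hfield s (Y w) - hfield s (Y w'))) \<le> (m / r) * (L * (r * norm (w - w')))"
            unfolding norm_scaleR using m r by (intro mult_mono Ydiff) auto
          also have "\<dots> = m * L * norm (w - w')" using r by simp
          also have "\<dots> \<le> \<epsilon> / 3 * norm (w - w')" by (intro mult_right_mono mL) auto
          finally show ?thesis .
        qed
        ultimately show ?thesis
          using norm_add_diff_le
            [of "((1 - m) / r) *\<^sub>R E" "\<epsilon> / 3 * norm (w - w')" "(m * K) *\<^sub>R h" "\<epsilon> / 3 * norm (w - w')"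
              "(m / r) *\<^sub>R (hfield s (Y w) - hfield s (Y w'))" "\<epsilon> / 3 * norm (w - w')"] by simp
      qed
      moreover have "norm (nonlin s r m u 0) \<le> \<epsilon> * \<delta>"
      proof -
        define E where "E = hfield s (Z 0) - hfield s (- of_real r) - hfield_deriv s (- of_real r) (m *\<^sub>R u)"
        define D where "D = hfield_deriv s (- of_real r) (m *\<^sub>R u)"
        have Zd: "Z 0 - (- of_real r) = m *\<^sub>R u"
          by (simp add: Z_def scaleR_conv_of_real)
        have "norm E \<le> \<epsilon> / 3 * norm (Z 0 - (- of_real r))"
          unfolding E_def Zd [symmetric] using \<delta> d by (intro strict Z) auto
        then have E: "norm E \<le> \<epsilon> / 3 * m"
          unfolding Zd using m u by simp
        have D: "norm D \<le> (1 + s) * K * m"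
          using norm_hfield_deriv [OF s, of "- of_real r" "m *\<^sub>R u"] r m u by (simp add: D_def K_def)
        have P0: "hfield s (- of_real r) = - (r * K) *\<^sub>R 1"
          using r by (simp add: hfield_def K_def powr_minus scaleR_conv_of_real)
        have ZE: "hfield s (Z 0) = E + D - (r * K) *\<^sub>R 1"
          using P0 by (simp add: E_def D_def)
        have "Y 0 = (1 - m) *\<^sub>R u + of_real r"
          by (simp add: Y_def scaleR_conv_of_real)
        then have "norm (Y 0) \<le> (1 - m) + r"
          using norm_triangle_ineq [of "(1 - m) *\<^sub>R u" "of_real r"] m r u by simp
        then have Y2: "norm (Y 0) \<le> 2" using m r by simp
        have cY: "c \<le> norm (Y 0)" using \<delta> by (intro far Y) simp
        have "norm (hfield s (Y 0)) \<le> c powr - s * 2"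
          unfolding norm_hfield using cY Y2 c s by (intro mult_mono powr_mono2') auto
        then have hY: "norm (m *\<^sub>R hfield s (Y 0)) \<le> m * (c powr - s * 2)"
          using m by simp
        have ED: "norm ((1 - m) *\<^sub>R (E + D)) \<le> 1 * ((1 + s) * K * m + \<epsilon> / 3 * m)"
          unfolding norm_scaleR using m norm_triangle_ineq [of E D] E D by (intro mult_mono) auto
        define V where "V = (1 - m) *\<^sub>R (E + D) - m *\<^sub>R hfield s (Y 0)"
        have "norm V \<le> (1 + s) * K * m + \<epsilon> / 3 * m + m * (c powr - s * 2)"
          unfolding V_def by (rule order_trans [OF norm_triangle_ineq4 add_mono [OF ED [unfolded mult_1] hY]])
        then have "norm V / r \<le> ((1 + s) * K * m + \<epsilon> / 3 * m + m * (c powr - s * 2)) / r"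
          using r by (intro divide_right_mono) auto
        also have "\<dots> = m * (((1 + s) * K + \<epsilon> / 3 + c powr - s * 2) / r)"
          using r by (simp add: field_simps)
        also have "norm V / r = norm (V /\<^sub>R r)"
          using r by (simp add: divide_inverse)
        finally have V: "norm (V /\<^sub>R r) \<le> m * (((1 + s) * K + \<epsilon> / 3 + c powr - s * 2) / r)" .
        have mK1: "norm ((m * K) *\<^sub>R (1 :: complex)) \<le> m * K"
          using m pos by simp
        \<comment> \<open>The same cancellation for the constant term:
          \<open>- (1 - m) * K + K = m * K\<close>.\<close>
        have "nonlin s r m u 0 = V /\<^sub>R r + (m * K) *\<^sub>R 1"
          unfolding split ZE V_def using r by (simp add: scaleR_conv_of_real field_simps)
        with norm_triangle_mono [OF V mK1]
        have "norm (nonlin s r m u 0) \<le> m * (((1 + s) * K + \<epsilon> / 3 + c powr - s * 2) / r) + m * K"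
          by (simp only:)
        also have "\<dots> = m * Q" by (simp add: Q_def algebra_simps)
        also note mQ
        finally show ?thesis .
      qed
      ultimately show ?thesis unfolding nonlin_small_def by blast
    qed
    ultimately show "\<exists>m0>0. \<forall>m u. 0 < m \<and> m < m0 \<and> norm u = 1 \<longrightarrow>
       nonlin_small s r \<epsilon> \<delta> m u"
      by blast
  qed
qed

section \<open>Symmetry of the remainder and return to the inertial frame\<close>

lemma nonlin_cnj: "nonlin s r m (cnj u) (cnj w) = cnj (nonlin s r m u w)"
proof -
  have Z: "m *\<^sub>R cnj u - r *\<^sub>R (1 + cnj w) = cnj (m *\<^sub>R u - r *\<^sub>R (1 + w))"
    and Y: "(1 - m) *\<^sub>R cnj u + r *\<^sub>R (1 + cnj w) = cnj ((1 - m) *\<^sub>R u + r *\<^sub>R (1 + w))"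
    by (simp_all add: complex_eq_iff)
  show ?thesis
    unfolding nonlin_def Z Y hfield_cnj by (simp add: complex_eq_iff)
qed

lemma has_vector_derivative_cis_mult:
  "((\<lambda>t. cis (k * t)) has_vector_derivative \<i> * of_real k * cis (k * t)) (at t)"
  by (auto simp: has_vector_derivative_complex_iff intro!: derivative_eq_intros)

text \<open>Integer \<open>k\<close> makes \<open>cis ((1 - k) * t)\<close> periodic with period
  \<open>2 * pi\<close>, the absence of collisions gives continuity, and \<open>nonlin_cnj\<close>
  gives the reflection symmetry.\<close>

lemma sym_periodic_nonlin:
  assumes w: "w \<in> sym_periodic" and k: "k \<in> \<int>"
    and ne: "\<And>t. m *\<^sub>R cis ((1 - k) * t) - r *\<^sub>R (1 + w t) \<noteq> 0"
      "\<And>t. (1 - m) *\<^sub>R cis ((1 - k) * t) + r *\<^sub>R (1 + w t) \<noteq> 0"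
  shows "(\<lambda>t. nonlin s r m (cis ((1 - k) * t)) (w t)) \<in> sym_periodic"
proof -
  have wc: "continuous_on UNIV w" and wp: "\<And>t. w (t + 2 * pi) = w t" and ws: "\<And>t. w (- t) = cnj (w t)"
    using w by (auto simp: sym_periodic_def)
  have hf: "continuous_on UNIV (\<lambda>t. hfield s (g t))" if "continuous_on UNIV g" "\<And>t. g t \<noteq> 0" for g
    using that by (intro continuous_on_compose2 [OF continuous_on_hfield [of "- {0}" s]]) auto
  have "continuous_on UNIV (\<lambda>t. nonlin s r m (cis ((1 - k) * t)) (w t))"
    unfolding nonlin_def by (intro continuous_intros hf wc ne)
  moreover have "cis ((1 - k) * (t + 2 * pi)) = cis ((1 - k) * t)" for t
  proof -
    have "cis ((1 - k) * (t + 2 * pi)) = cis ((1 - k) * t) * cis (2 * pi * (1 - k))"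
      by (simp add: cis_mult algebra_simps)
    also have "cis (2 * pi * (1 - k)) = 1"
      using k by (intro cis_multiple_2pi) auto
    finally show ?thesis by simp
  qed
  moreover have "cis ((1 - k) * - t) = cnj (cis ((1 - k) * t))" for t
    by (simp add: cis_cnj)
  ultimately show ?thesis
    by (simp only: sym_periodic_def mem_Collect_eq wp ws nonlin_cnj) simp
qed

text \<open>Both arguments of \<open>hfield\<close> contain the common rotation
  \<open>cis (k * t)\<close>, which equivariance pulls out; the subtracted term undoes the
  correction inside \<open>nonlin\<close>.\<close>

lemma r3bp_force_rotating:
  assumes "r > 0"
  shows "r3bp_force (s - 2) m t (r *\<^sub>R (cis (k * t) * (1 + w)))
    = r *\<^sub>R (cis (k * t) * (nonlin s r m (cis ((1 - k) * t)) w - (r powr - s) *\<^sub>R (1 + w - of_real (s * Re w))))"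
proof -
  have ct: "cis t = cis (k * t) * cis ((1 - k) * t)"
    by (simp add: cis_mult algebra_simps)
  have Z: "m *\<^sub>R cis t - r *\<^sub>R (cis (k * t) * (1 + w)) = cis (k * t) * (m *\<^sub>R cis ((1 - k) * t) - r *\<^sub>R (1 + w))"
    and Y: "(1 - m) *\<^sub>R cis t + r *\<^sub>R (cis (k * t) * (1 + w)) = cis (k * t) * ((1 - m) *\<^sub>R cis ((1 - k) * t) + r *\<^sub>R (1 + w))"
    unfolding ct by (simp_all add: scaleR_conv_of_real algebra_simps)
  show ?thesis
    unfolding r3bp_force_hfield Z Y nonlin_def diff_add_cancel hfield_mult_unit [OF norm_cis]
    using assms by (simp add: scaleR_conv_of_real field_simps)
qed

text \<open>The radius solves \<open>r powr - s = k\<^sup>2\<close>, the balance of attraction and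
  centrifugal force at angular speed \<open>k\<close>, and \<open>n \<ge> 2\<close> puts it inside
  the unit circle. The bound by \<open>\<eta>\<close> serves to tell orbits for different
  \<open>n\<close> apart.\<close>

lemma periodic_solution_near_circle:
  fixes n :: nat
  assumes \<alpha>: "0 < \<alpha>" "\<alpha> < 2" and n: "n \<ge> 2" and nonres: "real n * sqrt (2 - \<alpha>) \<notin> \<int>" and "\<eta> > 0"
  shows "\<exists>m0>0. \<forall>m. 0 < m \<and> m < m0 \<longrightarrow> (\<exists>q. r3bp_solution \<alpha> m q \<and> (\<forall>t. q (t + 2 * pi) = q t) \<and>
    dist (q 0) (of_real (real n powr (- 2 / (\<alpha> + 2)))) < \<eta>)"
proof -
  define s where "s = \<alpha> + 2"
  define k where "k = real n"
  define r where "r = k powr (- 2 / s)"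
  define \<omega> where "\<omega> = k * sqrt (2 - \<alpha>)"
  have s: "s > 2" and k: "k \<ge> 2" "k \<in> \<int>" using \<alpha> n by (auto simp: s_def k_def)
  have r: "0 < r" "r < 1"
    using s k by (auto simp: r_def powr_less_one divide_neg_pos)
  have "r powr - s = k powr 2"
    using s by (simp add: r_def powr_powr)
  then have rk: "r powr - s = k\<^sup>2" using k by (simp add: powr_numeral)
  have \<omega>: "\<omega> > 0" using k \<alpha> by (simp add: \<omega>_def)
  have \<omega>2: "\<omega>\<^sup>2 = k\<^sup>2 * (4 - s)" using \<alpha> by (simp add: \<omega>_def power_mult_distrib s_def)
  then have res: "\<omega>\<^sup>2 \<noteq> 4 * k\<^sup>2" using s k by simp
  have "sin (\<omega> * pi) \<noteq> 0"
    using nonres by (auto simp: sin_zero_iff_int2 \<omega>_def k_def)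
  from perturbed_linear_solution [OF \<omega> this res]
  obtain M where M: "M > 0" and solve: "\<And>\<delta> G. \<lbrakk>\<delta> > 0;
       \<And>w. w \<in> sym_periodic \<Longrightarrow> (\<And>t. norm (w t) \<le> \<delta>) \<Longrightarrow> (\<lambda>t. G t (w t)) \<in> sym_periodic;
       \<And>t w w'. norm w \<le> \<delta> \<Longrightarrow> norm w' \<le> \<delta> \<Longrightarrow> norm (G t w - G t w') \<le> norm (w - w') / (2 * M);
       \<And>t. norm (G t 0) \<le> \<delta> / (2 * M)\<rbrakk> \<Longrightarrow>
     \<exists>w v. w \<in> sym_periodic \<and> (\<forall>t. norm (w t) \<le> \<delta>) \<and>
       (\<forall>t. (w has_vector_derivative v t) (at t) \<and>
         (v has_vector_derivative G t (w t) - 2 * \<i> * of_real k * v t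
            + of_real ((4 * k\<^sup>2 - \<omega>\<^sup>2) * Re (w t))) (at t))"
    by blast
  have "0 \<le> s" "1 / (2 * M) > 0" using s M by auto
  from nonlin_estimate [OF r this]
  obtain \<delta>0 where \<delta>0: "\<delta>0 > 0" and est:
    "\<And>\<delta>. 0 < \<delta> \<Longrightarrow> \<delta> \<le> \<delta>0 \<Longrightarrow> \<exists>m0>0. \<forall>m u. 0 < m \<and> m < m0 \<and> norm u = 1 \<longrightarrow>
       nonlin_small s r (1 / (2 * M)) \<delta> m u"
    by blast
  \<comment> \<open>Since \<open>q 0\<close> will differ from \<open>r\<close> by
    \<open>r * w 0\<close> and \<open>r < 1\<close>, this keeps \<open>q 0\<close> within
    \<open>\<eta>\<close> of \<open>r\<close>.\<close>
  define \<delta> where "\<delta> = min \<delta>0 (\<eta> / 2)"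
  have \<delta>: "0 < \<delta>" "\<delta> \<le> \<delta>0" "\<delta> < \<eta>" using \<delta>0 \<open>\<eta> > 0\<close> by (auto simp: \<delta>_def)
  from est [OF \<delta>(1,2)] obtain m0 where "m0 > 0" and m0:
    "\<And>m u. \<lbrakk>0 < m; m < m0; norm u = 1\<rbrakk> \<Longrightarrow> nonlin_small s r (1 / (2 * M)) \<delta> m u"
    by blast
  have "\<exists>q. r3bp_solution \<alpha> m q \<and> (\<forall>t. q (t + 2 * pi) = q t) \<and> dist (q 0) (of_real r) < \<eta>"
    if m: "0 < m" "m < m0" for m
  proof -
    note small = m0 [OF m norm_cis, unfolded nonlin_small_def]
    define G where "G t = nonlin s r m (cis ((1 - k) * t))" for t
    have "\<exists>w v. w \<in> sym_periodic \<and> (\<forall>t. norm (w t) \<le> \<delta>) \<and>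
       (\<forall>t. (w has_vector_derivative v t) (at t) \<and>
         (v has_vector_derivative G t (w t) - 2 * \<i> * of_real k * v t
            + of_real ((4 * k\<^sup>2 - \<omega>\<^sup>2) * Re (w t))) (at t))"
    proof (rule solve [OF \<delta>(1)])
      show "(\<lambda>t. G t (w t)) \<in> sym_periodic" if "w \<in> sym_periodic" "\<And>t. norm (w t) \<le> \<delta>" for w
        unfolding G_def using small that by (intro sym_periodic_nonlin k) blast+
      show "norm (G t w - G t w') \<le> norm (w - w') / (2 * M)" if "norm w \<le> \<delta>" "norm w' \<le> \<delta>" for t w w'
        using small that by (simp add: G_def)
      show "norm (G t 0) \<le> \<delta> / (2 * M)" for t
        using small by (simp add: G_def)
    qed
    then obtain w v where w: "w \<in> sym_periodic" "\<And>t. norm (w t) \<le> \<delta>"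
      and dw: "\<And>t. (w has_vector_derivative v t) (at t)"
      and dv: "\<And>t. (v has_vector_derivative G t (w t) - 2 * \<i> * of_real k * v t
            + of_real ((4 * k\<^sup>2 - \<omega>\<^sup>2) * Re (w t))) (at t)"
      by blast
    define q where "q t = r *\<^sub>R (cis (k * t) * (1 + w t))" for t
    define p where "p t = r *\<^sub>R (cis (k * t) * (\<i> * of_real k * (1 + w t) + v t))" for t
    have ct: "cis t = cis (k * t) * cis ((1 - k) * t)" for t
      by (simp add: cis_mult algebra_simps)
    have "q t \<noteq> heavy_primary m t \<and> q t \<noteq> light_primary m t" for t
    proof -
      have "heavy_primary m t - q t = cis (k * t) * (m *\<^sub>R cis ((1 - k) * t) - r *\<^sub>R (1 + w t))"
        "q t - light_primary m t = cis (k * t) * ((1 - m) *\<^sub>R cis ((1 - k) * t) + r *\<^sub>R (1 + w t))"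
        unfolding q_def heavy_primary_def light_primary_def ct [of t]
        by (simp_all add: scaleR_conv_of_real algebra_simps)
      then show ?thesis
        using small w(2) by (metis cis_neq_zero mult_eq_0_iff right_minus_eq)
    qed
    moreover have "(q has_vector_derivative p t) (at t)" for t
      unfolding q_def [abs_def] p_def
      by (rule derivative_eq_intros has_vector_derivative_cis_mult dw refl | simp add: algebra_simps)+
    moreover have "(p has_vector_derivative r3bp_force \<alpha> m t (q t)) (at t)" for t
    proof -
      have "4 * k\<^sup>2 - \<omega>\<^sup>2 = k\<^sup>2 * s" by (simp add: \<omega>2 algebra_simps)
      have "(p has_vector_derivative r *\<^sub>R (cis (k * t) * (\<i> * of_real k * v t +
           (G t (w t) - 2 * \<i> * of_real k * v t + of_real ((4 * k\<^sup>2 - \<omega>\<^sup>2) * Re (w t))))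
         + \<i> * of_real k * cis (k * t) * (\<i> * of_real k * (1 + w t) + v t))) (at t)"
        unfolding p_def [abs_def]
        by (rule derivative_eq_intros has_vector_derivative_cis_mult dw dv refl | simp)+
      \<comment> \<open>The velocity terms cancel, and the square of \<open>\<i> * k\<close> gives
        \<open>- k\<^sup>2 * (1 + w)\<close>.\<close>
      also have "r *\<^sub>R (cis (k * t) * (\<i> * of_real k * v t +
           (G t (w t) - 2 * \<i> * of_real k * v t + of_real ((4 * k\<^sup>2 - \<omega>\<^sup>2) * Re (w t))))
         + \<i> * of_real k * cis (k * t) * (\<i> * of_real k * (1 + w t) + v t))
         = r *\<^sub>R (cis (k * t) * (G t (w t) - (k\<^sup>2) *\<^sub>R (1 + w t - of_real (s * Re (w t)))))"
        unfolding \<open>4 * k\<^sup>2 - \<omega>\<^sup>2 = k\<^sup>2 * s\<close>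
        by (simp add: scaleR_conv_of_real algebra_simps power2_eq_square)
      also have "\<dots> = r3bp_force (s - 2) m t (q t)"
        unfolding q_def r3bp_force_rotating [OF r(1)] G_def rk ..
      finally show ?thesis by (simp add: s_def)
    qed
    moreover have "q (t + 2 * pi) = q t" for t
    proof -
      have "cis (k * (t + 2 * pi)) = cis (k * t) * cis (2 * pi * k)"
        by (simp add: cis_mult algebra_simps)
      also have "cis (2 * pi * k) = 1" using k by (intro cis_multiple_2pi)
      finally show ?thesis using w(1) by (simp add: q_def sym_periodic_def)
    qed
    moreover have "dist (q 0) (of_real r) < \<eta>"
    proof -
      have "q 0 - of_real r = r *\<^sub>R w 0" by (simp add: q_def scaleR_conv_of_real algebra_simps)
      then have "dist (q 0) (of_real r) = r * norm (w 0)" using r by (simp add: dist_norm)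
      also have "\<dots> \<le> 1 * \<delta>" using r w(2) by (intro mult_mono) auto
      finally show ?thesis using \<delta> by simp
    qed
    ultimately show ?thesis unfolding r3bp_solution_def by blast
  qed
  with \<open>m0 > 0\<close> show ?thesis by (auto simp: r_def k_def s_def)
qed

subsection \<open>Several orbits\<close>

lemma infinite_nonresonant:
  assumes "0 < \<alpha>" "\<alpha> < 2" "\<alpha> \<noteq> (1 :: real)"
  shows "infinite {n :: nat. n \<ge> 2 \<and> real n * sqrt (2 - \<alpha>) \<notin> \<int>}"
  unfolding infinite_nat_iff_unbounded
proof
  fix b :: nat
  \<comment> \<open>This meets both \<open>n > b\<close> and \<open>n \<ge> 2\<close>; it and its
    successor cannot both be resonant.\<close>
  define n where "n = b + 2"
  show "\<exists>n>b. n \<in> {n. n \<ge> 2 \<and> real n * sqrt (2 - \<alpha>) \<notin> \<int>}"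
  proof (rule ccontr)
    assume "\<not> ?thesis"
    then have "real i * sqrt (2 - \<alpha>) \<in> \<int>" if "i > b" "i \<ge> 2" for i
      using that by blast
    from this [of n] this [of "n + 1"]
    have "real n * sqrt (2 - \<alpha>) \<in> \<int>" "real (n + 1) * sqrt (2 - \<alpha>) \<in> \<int>"
      by (simp_all add: n_def)
    then have "real (n + 1) * sqrt (2 - \<alpha>) - real n * sqrt (2 - \<alpha>) \<in> \<int>"
      by (rule Ints_diff [rotated])
    then have "sqrt (2 - \<alpha>) \<in> \<int>" by (simp add: algebra_simps)
    then obtain j :: int where j: "sqrt (2 - \<alpha>) = of_int j" by (auto elim: Ints_cases)
    have "0 < sqrt (2 - \<alpha>)" "sqrt (2 - \<alpha>) < 2"
      using assms by (auto intro: real_less_lsqrt)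
    with j have "j = 1" by linarith
    with j have "2 - \<alpha> = 1" by simp
    with assms show False by simp
  qed
qed

theorem theorem5p2:
  fixes \<alpha> :: real and N :: nat
  assumes "0 < \<alpha>" and "\<alpha> < 2" and "\<alpha> \<noteq> 1" and "N \<ge> 1"
  shows "\<exists>mstar>0. \<forall>m::real. 0 < m \<and> m < mstar \<and> m < 1 \<longrightarrow>
           (\<exists>Q :: (real \<Rightarrow> complex) set. finite Q \<and> card Q = N \<and>
              (\<forall>q\<in>Q. r3bp_solution \<alpha> m q \<and> (\<forall>t. q (t + 2 * pi) = q t)))"
proof -
  obtain I where I: "finite I" "card I = N" "I \<subseteq> {n :: nat. n \<ge> 2 \<and> real n * sqrt (2 - \<alpha>) \<notin> \<int>}"
    using infinite_arbitrarily_large [OF infinite_nonresonant [OF assms(1-3)]] by blast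
  define r where "r n = real n powr (- 2 / (\<alpha> + 2))" for n
  have r_inj: "r i \<noteq> r j" if "i \<in> I" "j \<in> I" "i \<noteq> j" for i j
  proof -
    have "- 2 / (\<alpha> + 2) < 0" "0 < real i" "0 < real j"
      using assms that I(3) by (auto simp: divide_neg_pos)
    from powr_less_mono2_neg [OF this(1,2), of "real j"] powr_less_mono2_neg [OF this(1,3), of "real i"]
    show ?thesis using that(3) unfolding r_def by (cases i j rule: linorder_cases) auto
  qed
  \<comment> \<open>The element \<open>1\<close> keeps the set of gaps nonempty when
    \<open>I\<close> has a single element.\<close>
  define D where "D = insert 1 ((\<lambda>(i, j). \<bar>r i - r j\<bar>) ` {(i, j) \<in> I \<times> I. i \<noteq> j})"
  define \<eta> where "\<eta> = Min D / 2"
  have D: "finite D" "D \<noteq> {}"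
    using finite_subset [of "{(i, j) \<in> I \<times> I. i \<noteq> j}" "I \<times> I"] I(1) by (auto simp: D_def)
  have "\<eta> > 0" using D r_inj by (auto simp: \<eta>_def D_def)
  have gap: "2 * \<eta> \<le> \<bar>r i - r j\<bar>" if "i \<in> I" "j \<in> I" "i \<noteq> j" for i j
  proof -
    have "\<bar>r i - r j\<bar> \<in> D" using that by (auto simp: D_def)
    with D show ?thesis by (simp add: \<eta>_def)
  qed
  have "\<forall>n\<in>I. \<exists>m0>0. \<forall>m. 0 < m \<and> m < m0 \<longrightarrow>
      (\<exists>q. r3bp_solution \<alpha> m q \<and> (\<forall>t. q (t + 2 * pi) = q t) \<and> dist (q 0) (of_real (r n)) < \<eta>)"
    unfolding r_def using I \<open>\<eta> > 0\<close> assms by (intro ballI periodic_solution_near_circle) auto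
  then obtain m0 where m0: "\<And>n. n \<in> I \<Longrightarrow> m0 n > 0"
    "\<And>n m. \<lbrakk>n \<in> I; 0 < m; m < m0 n\<rbrakk> \<Longrightarrow>
      \<exists>q. r3bp_solution \<alpha> m q \<and> (\<forall>t. q (t + 2 * pi) = q t) \<and> dist (q 0) (of_real (r n)) < \<eta>"
    by metis
  define mstar where "mstar = Min (insert 1 (m0 ` I))"
  have "mstar > 0" using I m0(1) by (simp add: mstar_def)
  moreover have "\<exists>Q. finite Q \<and> card Q = N \<and>
      (\<forall>q\<in>Q. r3bp_solution \<alpha> m q \<and> (\<forall>t. q (t + 2 * pi) = q t))" if m: "0 < m" "m < mstar" for m
  proof -
    have "\<forall>n\<in>I. \<exists>q. r3bp_solution \<alpha> m q \<and> (\<forall>t. q (t + 2 * pi) = q t) \<and> dist (q 0) (of_real (r n)) < \<eta>"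
      using m m0(2) I(1) by (simp add: mstar_def)
    then obtain q where q: "\<And>n. n \<in> I \<Longrightarrow> r3bp_solution \<alpha> m (q n)"
      "\<And>n t. n \<in> I \<Longrightarrow> q n (t + 2 * pi) = q n t"
      "\<And>n. n \<in> I \<Longrightarrow> dist (q n 0) (of_real (r n)) < \<eta>"
      by metis
    \<comment> \<open>Equal solutions would start within \<open>\<eta>\<close> of two radii that are
      at least \<open>2 * \<eta>\<close> apart.\<close>
    have "inj_on q I"
    proof (rule inj_onI, rule ccontr)
      fix i j assume ij: "i \<in> I" "j \<in> I" "q i = q j" "i \<noteq> j"
      have "\<bar>r i - r j\<bar> = dist (complex_of_real (r i)) (of_real (r j))"
        by (simp add: dist_of_real dist_real_def)
      also have "\<dots> \<le> dist (q i 0) (of_real (r i)) + dist (q j 0) (of_real (r j))"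
        unfolding ij(3) by (metis dist_commute dist_triangle)
      also have "\<dots> < 2 * \<eta>" using q(3) ij(1,2) by (smt (verit))
      finally show False using gap [OF ij(1,2,4)] by simp
    qed
    then show ?thesis
      using I q by (intro exI [of _ "q ` I"]) (auto simp: card_image)
  qed
  ultimately show ?thesis by blast
qed

end
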